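(* Let $n\ge 1$, let $H\in\mathbb{R}^{n\times n}$ be a Hankel matrix, let $\lambda\in\mathbb{C}$, and let $x\in\mathbb{C}^n$ be a nonzero vector. Let $S\in\{0,1\}^{n^2\times(2n-1)}$ be the Hankel structure matrix, so that $\operatorname{vec}(\Delta H)=Sz$, $z\in\mathbb{R}^{2n-1}$, parameterizes all (real) Hankel perturbations $\Delta H\in\mathbb{R}^{n\times n}$. Define $$r:=\lambda x-Hx\in\mathbb{C}^n,\qquad C:=(I_n\otimes x^T)S\in\mathbb{C}^{n\times(2n-1)},$$ and consider the two optimization problems $$\text{(A)}\qquad \min_{z\in\mathbb{R}^{2n-1}}\ \|Sz\|_2^2\quad\text{subject to}\quad Cz=r,\quad Sz\ge-\operatorname{vec}(H),$$ $$\text{(B)}\qquad \min_{z\in\mathbb{R}^{2n-1}}\ \|Cz-r\|_2^2\quad\text{subject to}\quad Sz\ge-\operatorname{vec}(H).$$ Then the following hold. (i) (Feasibility equivalence.) There exists a nonnegative Hankel matrix $\widehat H=H+\Delta H$ with $\widehat Hx=\lambda x$ if and only if the system $Cz=r$, $Sz\ge-\operatorname{vec}(H)$ has a solution $z\in\mathbb{R}^{2n-1}$. In that case, for every solution $z$, setting $\Delta H=\operatorname{vec}^{-1}(Sz)$, the matrix $\widehat H=H+\Delta H$ is a nonnegative Hankel matrix with $\widehat Hx=\lambda x$. (ii) (Optimality of (A).) If (A) is feasible, then any global minimizer $z^\star$ of (A) yields a perturbation $\Delta H^\star=\operatorname{vec}^{-1}(Sz^\star)$ such that: (1) $\widehat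 H=H+\Delta H^\star$ is nonnegative and satisfies $\widehat Hx=\lambda x$; (2) $\Delta H^\star$ has minimum Frobenius norm among all Hankel perturbations producing a nonnegative matrix with this exact eigenpair, i.e. $$\|\Delta H^\star\|_F=\min\{\|\Delta H\|_F:\ (H+\Delta H)x=\lambda x,\ H+\Delta H\ge 0,\ \Delta H\text{ Hankel}\};$$ (3) problem (A) is a convex quadratic program and a global minimizer exists; moreover $z^\star$ (hence $\Delta H^\star$) is unique whenever the quadratic form $z\mapsto z^T(S^TS)z$ is strictly convex on the feasible set of (A) (for example, if $S^TS$ is positive definite on the nullspace $\{d\in\mathbb{R}^{2n-1}: Cd=0\}$ of the equality constraints). (iii) (Correctness of (B).) If (A) is infeasible, then any minimizer $\tilde z$ of (B) yields, via $\widetilde{\Delta H}=\operatorname{vec}^{-1}(S\tilde z)$ and $\widehat H=H+\widetilde{\Delta H}$, a nonnegative Hankel matrix $\widehat H$ that minimizes the eigenpair residual $$\|\widehat Hx-\lambda x\|_2=\|C\tilde z-r\|_2$$ among all nonnegative Hankel matrices in $\mathbb{R}^{n\times n}$. Problem (B) is a convex quadratic program and admits a global minimizer; the minimizer is unique whenever the quadratic form $z\mapsto\|Cz\|_2^2=z^T(C^HC)z$ is strictly convex on the feasible set of (B). (iv) (Relationship of (A) and (B).) If (A) is feasible, then any minimizer $z^\star$ of (A) satisfies $\|Cz^\star-r\|_2=0$ and yields a perturbation $\Delta H^\star=\operatorname{vec}^{-1}(Sz^\star)$ of smallest Frobenius norm among all Hankel perturbations $\Delta H$ with $H+\Delta H\ge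 0$ and $(H+\Delta H)x=\lambda x$. If (A) is infeasible, then a minimizer of (B) gives the best least-squares approximation to the eigenpair relation (smallest $\|\widehat Hx-\lambda x\|_2$) under the Hankel and nonnegativity constraints, but it does not in general minimize $\|\Delta H\|_F$: there are instances $(H,\lambda,x)$ with (A) infeasible and a minimizer $\tilde z$ of (B) for which $\operatorname{vec}^{-1}(S\tilde z)$ does not have minimum Frobenius norm among all Hankel $\Delta H$ with $H+\Delta H\ge 0$.
   Context: A matrix $H=[h_{ij}]\in\mathbb{R}^{n\times n}$ is Hankel if it is constant along anti-diagonals: $h_{ij}=c_{i+j-1}$ for some vector $c=(c_1,\dots,c_{2n-1})^T$. A Hankel perturbation is a real $n\times n$ Hankel matrix $\Delta H$ added to $H$. A matrix is nonnegative, written $A\ge 0$, if all its entries are real and $\ge 0$; inequalities between real vectors are componentwise. For $A=[a_{ij}]\in\mathbb{C}^{n\times n}$, $\operatorname{vec}(A)\in\mathbb{C}^{n^2}$ is the vector obtained by stacking the columns of $A$, and $\operatorname{vec}^{-1}$ reshapes a vector of length $n^2$ back into an $n\times n$ matrix. $\otimes$ is the Kronecker product, $I_n$ is the identity matrix, $A^T$ is the transpose and $A^H$ the conjugate transpose (so $x^T$ is the transpose without conjugation). $\|\cdot\|_2$ is the Euclidean norm on $\mathbb{C}^m$ and $\|A\|_F=(\sum_{i,j}|a_{ij}|^2)^{1/2}$ is the Frobenius norm. The Hankel structure matrix $S\in\{0,1\}^{n^2\times(2n-1)}$ is defined by $S_{(j-1)n+i,\,k}=1$ if $k=i+j-1$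 and $0$ otherwise, for $1\le i,j\le n$, $1\le k\le 2n-1$. Thus $Sz=\operatorname{vec}$ of the Hankel matrix with $(i,j)$ entry $z_{i+j-1}$. "Feasible" for (A) or (B) means that the constraint set is nonempty. The complex equality $Cz=r$ with $z$ real means equality of both real and imaginary parts. *)

theory Defs
  imports
    "HOL-Analysis.L2_Norm"
    "Jordan_Normal_Form.Schur_Decomposition"
begin

(* Matrices and vectors are those of Jordan_Normal_Form, so all indices start at 0. *)

abbreviation cvec :: "real vec \<Rightarrow> complex vec" where
  "cvec \<equiv> map_vec complex_of_real"

abbreviation cmat :: "real mat \<Rightarrow> complex mat" where
  "cmat \<equiv> map_mat complex_of_real"

definition norm2 :: "'a::real_normed_vector vec \<Rightarrow> real" where
  "norm2 v = L2_set (\<lambda>i. norm (v $ i)) {..<dim_vec v}"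

definition frobenius :: "'a::real_normed_vector mat \<Rightarrow> real" where
  "frobenius A = sqrt (\<Sum>i<dim_row A. \<Sum>j<dim_col A. (norm (A $$ (i, j)))\<^sup>2)"

definition nonneg_mat :: "real mat \<Rightarrow> bool" where
  "nonneg_mat A \<longleftrightarrow> (\<forall>i<dim_row A. \<forall>j<dim_col A. 0 \<le> A $$ (i, j))"

definition vectorize :: "'a mat \<Rightarrow> 'a vec" where
  "vectorize A = vec (dim_row A * dim_col A) (\<lambda>p. A $$ (p mod dim_row A, p div dim_row A))"

definition unvectorize :: "nat \<Rightarrow> 'a vec \<Rightarrow> 'a mat" where
  "unvectorize n v = mat n n (\<lambda>(i, j). v $ (j * n + i))"

definition kronecker :: "'a::times mat \<Rightarrow> 'a mat \<Rightarrow> 'a mat" where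
  "kronecker A B = mat (dim_row A * dim_row B) (dim_col A * dim_col B)
     (\<lambda>(i, j). A $$ (i div dim_row B, j div dim_col B) * B $$ (i mod dim_row B, j mod dim_col B))"

definition quad_form :: "'a::comm_semiring_0 mat \<Rightarrow> 'a vec \<Rightarrow> 'a" where
  "quad_form Q z = z \<bullet> (Q *\<^sub>v z)"

definition hankel :: "nat \<Rightarrow> 'a mat \<Rightarrow> bool" where
  "hankel n H \<longleftrightarrow> H \<in> carrier_mat n n \<and>
     (\<exists>c \<in> carrier_vec (2 * n - 1). \<forall>i<n. \<forall>j<n. H $$ (i, j) = c $ (i + j))"

(* Row p = j * n + i is the position of entry (i, j) under column stacking. *)
definition hankel_S :: "nat \<Rightarrow> 'a::zero_neq_one mat" where
  "hankel_S n = mat (n * n) (2 * n - 1) (\<lambda>(p, k). if k = p mod n + p div n then 1 else 0)"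

definition hankel_C :: "nat \<Rightarrow> complex vec \<Rightarrow> complex mat" where
  "hankel_C n x = kronecker (1\<^sub>m n) (mat_of_row x) * hankel_S n"

definition hankel_r :: "real mat \<Rightarrow> complex \<Rightarrow> complex vec \<Rightarrow> complex vec" where
  "hankel_r H lam x = lam \<cdot>\<^sub>v x - cmat H *\<^sub>v x"

definition feasible_A :: "nat \<Rightarrow> real mat \<Rightarrow> complex \<Rightarrow> complex vec \<Rightarrow> real vec set" where
  "feasible_A n H lam x = {z \<in> carrier_vec (2 * n - 1).
     hankel_C n x *\<^sub>v cvec z = hankel_r H lam x \<and> - vectorize H \<le> hankel_S n *\<^sub>v z}"

definition feasible_B :: "nat \<Rightarrow> real mat \<Rightarrow> real vec set" where
  "feasible_B n H = {z \<in> carrier_vec (2 * n - 1). - vectorize H \<le> hankel_S n *\<^sub>v z}"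

definition objective_A :: "nat \<Rightarrow> real vec \<Rightarrow> real" where
  "objective_A n z = (norm2 ((hankel_S n :: real mat) *\<^sub>v z))\<^sup>2"

definition objective_B ::
  "nat \<Rightarrow> real mat \<Rightarrow> complex \<Rightarrow> complex vec \<Rightarrow> real vec \<Rightarrow> real" where
  "objective_B n H lam x z = (norm2 (hankel_C n x *\<^sub>v cvec z - hankel_r H lam x))\<^sup>2"

abbreviation minimizer :: "('a \<Rightarrow> real) \<Rightarrow> 'a set \<Rightarrow> 'a \<Rightarrow> bool" where
  "minimizer f X z \<equiv> is_arg_min f (\<lambda>y. y \<in> X) z"

definition perturbation :: "nat \<Rightarrow> real vec \<Rightarrow> real mat" where
  "perturbation n z = unvectorize n (hankel_S n *\<^sub>v z)"

definition exact_perturbations ::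
  "nat \<Rightarrow> real mat \<Rightarrow> complex \<Rightarrow> complex vec \<Rightarrow> real mat set" where
  "exact_perturbations n H lam x =
     {D. hankel n D \<and> nonneg_mat (H + D) \<and> cmat (H + D) *\<^sub>v x = lam \<cdot>\<^sub>v x}"

definition strictly_convex_on :: "real vec set \<Rightarrow> (real vec \<Rightarrow> real) \<Rightarrow> bool" where
  "strictly_convex_on X f \<longleftrightarrow> (\<forall>u\<in>X. \<forall>v\<in>X. \<forall>t. u \<noteq> v \<longrightarrow> 0 < t \<longrightarrow> t < 1 \<longrightarrow>
     f ((1 - t) \<cdot>\<^sub>v u + t \<cdot>\<^sub>v v) < (1 - t) * f u + t * f v)"

definition positive_definite_on :: "real vec set \<Rightarrow> real mat \<Rightarrow> bool" where
  "positive_definite_on V Q \<longleftrightarrow> (\<forall>d\<in>V. d \<noteq> 0\<^sub>v (dim_vec d) \<longrightarrow> 0 < quad_form Q d)"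

definition convex_quadratic_program ::
  "nat \<Rightarrow> (real vec \<Rightarrow> real) \<Rightarrow> real vec set \<Rightarrow> bool" where
  "convex_quadratic_program m f X \<longleftrightarrow> (\<exists>Q q c k A b l G h.
     Q \<in> carrier_mat m m \<and> transpose_mat Q = Q \<and> (\<forall>d\<in>carrier_vec m. 0 \<le> quad_form Q d) \<and>
     q \<in> carrier_vec m \<and> (\<forall>z\<in>carrier_vec m. f z = quad_form Q z + q \<bullet> z + c) \<and>
     A \<in> carrier_mat k m \<and> b \<in> carrier_vec k \<and> G \<in> carrier_mat l m \<and> h \<in> carrier_vec l \<and>
     X = {z \<in> carrier_vec m. A *\<^sub>v z = b \<and> h \<le> G *\<^sub>v z})"

lemma hankel_S_mult_vec:
  fixes z :: "'a::comm_semiring_1 vec"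
  assumes z: "z \<in> carrier_vec (2 * n - 1)"
  shows "hankel_S n *\<^sub>v z = vectorize (mat n n (\<lambda>(i, j). z $ (i + j)))"
proof (rule eq_vecI)
  fix p assume "p < dim_vec (vectorize (mat n n (\<lambda>(i, j). z $ (i + j))))"
  then have p: "p < n * n" by (simp add: vectorize_def)
  then have n: "0 < n" by (cases n) auto
  have m: "p mod n < n" "p div n < n"
    using n p by (simp_all add: less_mult_imp_div_less)
  then have s: "p mod n + p div n < 2 * n - 1" by linarith
  have "(hankel_S n *\<^sub>v z) $ p =
      (\<Sum>k\<in>{0..<2 * n - 1}. (if k = p mod n + p div n then 1 else 0) * z $ k)"
    using p z by (simp add: hankel_S_def scalar_prod_def)
  also have "\<dots> = (\<Sum>k\<in>{0..<2 * n - 1}. if k = p mod n + p div n then z $ k else 0)"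
    by (rule sum.cong) auto
  also have "\<dots> = z $ (p mod n + p div n)"
    using s by (simp add: sum.delta)
  finally show "(hankel_S n *\<^sub>v z) $ p = vectorize (mat n n (\<lambda>(i, j). z $ (i + j))) $ p"
    using p m by (simp add: vectorize_def)
qed (simp add: hankel_S_def vectorize_def)

lemma unvectorize_vectorize:
  assumes A: "A \<in> carrier_mat n n"
  shows "unvectorize n (vectorize A) = A"
proof (rule eq_matI)
  fix i j assume "i < dim_row A" "j < dim_col A"
  then have ij: "i < n" "j < n" using A by auto
  have "j * n + i < Suc j * n" using ij by simp
  also have "\<dots> \<le> n * n" using ij by (intro mult_le_mono1) simp
  finally show "unvectorize n (vectorize A) $$ (i, j) = A $$ (i, j)"
    using ij A by (simp add: unvectorize_def vectorize_def)
qed (use A in \<open>auto simp: unvectorize_def\<close>)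

lemma hankel_iff_perturbation:
  "hankel n D \<longleftrightarrow> (\<exists>z\<in>carrier_vec (2 * n - 1). D = perturbation n z)"
proof -
  have *: "perturbation n z = mat n n (\<lambda>(i, j). z $ (i + j))"
    if "z \<in> carrier_vec (2 * n - 1)" for z
    using that by (simp add: perturbation_def hankel_S_mult_vec unvectorize_vectorize)
  show ?thesis
    by (auto simp: hankel_def * intro!: bexI eq_matI)
qed

end

theory Submission
  imports Defs "HOL-Analysis.Function_Topology"
begin

text \<open>
  Two identities carry everything. A vector \<open>z\<close> of length \<open>2 * n - 1\<close> and the Hankel matrix
  \<open>perturbation n z\<close> determine each other, and \<open>hankel_C n x *\<^sub>v cvec z\<close> is that matrix applied
  to \<open>x\<close> (lemma \<open>hankel_C_mult\<close>: a Hankel matrix is symmetric, so the transpose produced by the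
  Kronecker product disappears). Hence the constraints of (A) and (B) say that
  \<open>H + perturbation n z\<close> is nonnegative, and for (A) also that it has the eigenpair; the objective of
  (A) is the squared Frobenius norm of the perturbation, and that of (B) is the squared eigenpair
  residual. With this dictionary the equivalence of feasibility and the optimality statements are
  reformulations.

  Both problems are convex quadratic programs over the reals: stacking the real and imaginary parts
  of the rows of a complex matrix turns its norms into Gram quadratic forms. Strict convexity makes
  the minimizer unique because the midpoint of two minimizers would be better.

  Existence of a minimizer differs for the two problems. The objective of (A) dominates the square of
  every component of \<open>z\<close>, so its sublevel sets are bounded and compactness suffices. For (B) the matrix
  may have a kernel. Writing \<open>H\<close> as \<open>perturbation n c\<close> and substituting \<open>w = c + z\<close>, the problem
  becomes a nonnegative least squares problem: minimize the norm of \<open>(\<Sum>k. w k *\<^sub>R a k) - b\<close> over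
  \<open>w \<ge> 0\<close>. This always has a solution (\<open>nonneg_residual_attains_min\<close>), by induction on the number of
  columns: if some nontrivial nonnegative combination of the columns vanishes, every \<open>w\<close> can be moved
  against it without changing the residual until a coordinate becomes zero, so finitely many smaller
  problems decide; otherwise the residual is coercive on the orthant.

  The example separating (B) from minimal Frobenius norm takes \<open>H = 0\<close>, \<open>x\<close> the all-ones vector and
  eigenvalue \<open>1 + \<i>\<close>: the matrix with all entries \<open>1 / n\<close> is residual-optimal, but the zero
  perturbation is already nonnegative.
\<close>

section \<open>Nonnegative least squares\<close>

text \<open>Tychonoff's theorem; the index type may be infinite.\<close>

lemma compact_fun_box: "compact {w :: 'k \<Rightarrow> real. \<forall>k. w k \<in> {- R..R}}"
proof -
  have "{w :: 'k \<Rightarrow> real. \<forall>k. w k \<in> {- R..R}} = PiE UNIV (\<lambda>_. {- R..R})"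
    by (auto simp: PiE_def)
  moreover have "compactin (product_topology (\<lambda>_::'k. euclideanreal) UNIV)
      (PiE UNIV (\<lambda>_. {- R..R}))"
    by (subst compactin_PiE) auto
  ultimately show ?thesis
    by (simp add: euclidean_product_topology)
qed

lemma bounded_sublevel_attains_min:
  fixes f :: "('k \<Rightarrow> real) \<Rightarrow> real"
  assumes X: "closed X" and f: "continuous_on UNIV f" and w0: "w0 \<in> X"
    and bd: "\<And>w k. w \<in> X \<Longrightarrow> f w \<le> f w0 \<Longrightarrow> \<bar>w k\<bar> \<le> R"
  shows "\<exists>w\<in>X. \<forall>v\<in>X. f w \<le> f v"
proof -
  let ?B = "{w. \<forall>k. w k \<in> {- R..R}}"
  let ?L = "?B \<inter> (X \<inter> {w. f w \<le> f w0})"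
  have "closed {w. f w \<le> f w0}"
    using f by (intro closed_Collect_le continuous_on_const)
  then have "compact ?L"
    using X by (intro compact_Int_closed compact_fun_box closed_Int)
  moreover have mem: "w \<in> ?L" if "w \<in> X" "f w \<le> f w0" for w
    using bd[OF that] that by (auto simp: abs_le_iff minus_le_iff)
  moreover have "continuous_on ?L f"
    using f continuous_on_subset by blast
  ultimately obtain w where w: "w \<in> ?L" "\<And>v. v \<in> ?L \<Longrightarrow> f w \<le> f v"
    using continuous_attains_inf[of ?L f] w0 by blast
  show ?thesis
    using w mem by (metis (no_types, lifting) IntD1 IntD2 mem_Collect_eq nle_le order_trans)
qed

text \<open>
  The Euclidean norm of \<open>\<Sum>k\<in>K. w k *\<^sub>R a k - b\<close>, where the columns \<open>a k\<close> and the target \<open>b\<close> are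
  families indexed by \<open>I\<close>. The weights \<open>w\<close> are total functions; only their values on \<open>K\<close> matter.
\<close>

definition residual ::
  "'i set \<Rightarrow> ('k \<Rightarrow> 'i \<Rightarrow> 'v::real_normed_vector) \<Rightarrow> ('i \<Rightarrow> 'v) \<Rightarrow> 'k set \<Rightarrow> ('k \<Rightarrow> real) \<Rightarrow> real" where
  "residual I a b K w = L2_set (\<lambda>i. norm ((\<Sum>k\<in>K. w k *\<^sub>R a k i) - b i)) I"

lemma continuous_residual: "continuous_on UNIV (residual I a b K)"
  unfolding residual_def L2_set_def
  by (intro continuous_intros continuous_on_product_coordinates)

lemma residual_nonneg: "0 \<le> residual I a b K w"
  by (simp add: residual_def L2_set_nonneg)

lemma residual_cong:
  assumes "\<And>i. i \<in> I \<Longrightarrow> (\<Sum>k\<in>K. w k *\<^sub>R a k i) = (\<Sum>k\<in>L. v k *\<^sub>R a k i)"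
  shows "residual I a b K w = residual I a b L v"
  unfolding residual_def by (intro L2_set_cong) (simp_all add: assms)

text \<open>
  If no nontrivial nonnegative combination of the columns vanishes, then the minimum of the norm over
  the standard simplex is positive, and by homogeneity it serves as the constant.
\<close>

lemma residual_coercive:
  fixes a :: "'k \<Rightarrow> 'i \<Rightarrow> 'v::real_normed_vector"
  assumes fin: "finite K" "finite I"
    and no_kernel: "\<And>d. \<forall>k\<in>K. 0 \<le> d k \<Longrightarrow> \<forall>i\<in>I. (\<Sum>k\<in>K. d k *\<^sub>R a k i) = 0 \<Longrightarrow> \<forall>k\<in>K. d k = 0"
  shows "\<exists>c>0. \<forall>w. (\<forall>k\<in>K. 0 \<le> w k) \<longrightarrow> c * (\<Sum>k\<in>K. w k) \<le> residual I a (\<lambda>_. 0) K w"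
proof (cases "K = {}")
  case True
  then show ?thesis
    by (intro exI[of _ 1]) (simp add: residual_nonneg)
next
  case False
  then obtain k0 where k0: "k0 \<in> K" by blast
  let ?N = "residual I a (\<lambda>_. 0) K"
  let ?X = "{w :: 'k \<Rightarrow> real. \<forall>k\<in>K. 0 \<le> w k} \<inter> {w. \<forall>k\<in>- K. w k = 0} \<inter> {w. (\<Sum>k\<in>K. w k) = 1}"
  have "closed {w :: 'k \<Rightarrow> real. \<forall>k\<in>K. 0 \<le> w k}" "closed {w :: 'k \<Rightarrow> real. \<forall>k\<in>- K. w k = 0}"
    "closed {w :: 'k \<Rightarrow> real. (\<Sum>k\<in>K. w k) = 1}"
    unfolding Ball_def
    by (intro closed_Collect_all closed_Collect_imp open_Collect_const closed_Collect_le
        closed_Collect_eq continuous_intros continuous_on_product_coordinates)+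
  then have cl: "closed ?X"
    by (intro closed_Int)
  have bd: "\<bar>w k\<bar> \<le> 1" if "w \<in> ?X" for w k
  proof (cases "k \<in> K")
    case True
    have "w k \<le> (\<Sum>k\<in>K. w k)"
      using that fin True by (intro member_le_sum) auto
    then show ?thesis using that True by auto
  qed (use that in auto)
  have mem: "(\<lambda>k. if k = k0 then 1 else 0) \<in> ?X"
    using k0 fin by auto
  have "\<exists>w\<in>?X. \<forall>v\<in>?X. ?N w \<le> ?N v"
    by (rule bounded_sublevel_attains_min[OF cl continuous_residual mem]) (rule bd)
  then obtain w where w: "w \<in> ?X" and min: "\<And>v. v \<in> ?X \<Longrightarrow> ?N w \<le> ?N v"
    by blast
  have "?N w \<noteq> 0"
  proof
    assume "?N w = 0"
    then have "\<forall>i\<in>I. (\<Sum>k\<in>K. w k *\<^sub>R a k i) = 0"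
      using fin by (simp add: residual_def L2_set_eq_0_iff)
    then have "\<forall>k\<in>K. w k = 0"
      using w by (intro no_kernel) auto
    then show False using w by simp
  qed
  then have pos: "?N w > 0"
    using residual_nonneg[of I a "\<lambda>_. 0" K w] by linarith
  have "?N w * (\<Sum>k\<in>K. v k) \<le> ?N v" if v: "\<forall>k\<in>K. 0 \<le> v k" for v
  proof (cases "(\<Sum>k\<in>K. v k) = 0")
    case True
    then show ?thesis by (simp add: residual_nonneg)
  next
    case False
    define s where "s = (\<Sum>k\<in>K. v k)"
    have s: "s > 0"
      using False v by (simp add: s_def sum_nonneg order.not_eq_order_implies_strict)
    have "(\<lambda>k. if k \<in> K then v k / s else 0) \<in> ?X"
      using v s by (auto simp flip: sum_divide_distrib s_def)
    from min[OF this] have "s * ?N w \<le> s * ?N (\<lambda>k. if k \<in> K then v k / s else 0)"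
      using s by (intro mult_left_mono) auto
    also have "\<dots> = ?N v"
    proof -
      have "s *\<^sub>R (\<Sum>k\<in>K. (if k \<in> K then v k / s else 0) *\<^sub>R a k i) = (\<Sum>k\<in>K. v k *\<^sub>R a k i)" for i
        unfolding scaleR_sum_right using s by (intro sum.cong) auto
      then have "s * norm (\<Sum>k\<in>K. (if k \<in> K then v k / s else 0) *\<^sub>R a k i) =
          norm (\<Sum>k\<in>K. v k *\<^sub>R a k i)" for i
        using s by (metis abs_of_pos norm_scaleR)
      then show ?thesis
        using s by (simp only: residual_def L2_set_right_distrib less_imp_le diff_zero)
    qed
    finally show ?thesis by (simp add: s_def mult.commute)
  qed
  then show ?thesis using pos by blast
qed

text \<open>
  No condition on the columns is needed: the cone that they span is closed.
\<close>

theorem nonneg_residual_attains_min: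
  fixes a :: "'k \<Rightarrow> 'i \<Rightarrow> 'v::real_normed_vector"
  assumes "finite K" and I: "finite I"
  shows "\<exists>w. (\<forall>k\<in>K. 0 \<le> w k) \<and>
    (\<forall>v. (\<forall>k\<in>K. 0 \<le> v k) \<longrightarrow> residual I a b K w \<le> residual I a b K v)"
  using \<open>finite K\<close>
proof (induction K rule: finite_psubset_induct)
  case (psubset K)
  let ?F = "residual I a b"
  show ?case
  proof (cases "\<exists>d. (\<forall>k\<in>K. 0 \<le> d k) \<and> (\<forall>i\<in>I. (\<Sum>k\<in>K. d k *\<^sub>R a k i) = 0) \<and> (\<exists>k\<in>K. d k \<noteq> 0)")
    case True
    then obtain d k0 where d: "\<forall>k\<in>K. 0 \<le> d k" "\<forall>i\<in>I. (\<Sum>k\<in>K. d k *\<^sub>R a k i) = 0"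
      and k0: "k0 \<in> K" "d k0 \<noteq> 0" by blast
    \<comment> \<open>\<open>W j\<close> solves the problem on the face of the orthant where coordinate \<open>j\<close> vanishes.\<close>
    have "\<forall>j\<in>K. \<exists>w. (\<forall>k\<in>K - {j}. 0 \<le> w k) \<and>
        (\<forall>v. (\<forall>k\<in>K - {j}. 0 \<le> v k) \<longrightarrow> ?F (K - {j}) w \<le> ?F (K - {j}) v)"
      by (intro ballI psubset.IH) auto
    then obtain W where W: "\<And>j k. j \<in> K \<Longrightarrow> k \<in> K - {j} \<Longrightarrow> 0 \<le> W j k"
      and Wmin: "\<And>j v. j \<in> K \<Longrightarrow> \<forall>k\<in>K - {j}. 0 \<le> v k \<Longrightarrow> ?F (K - {j}) (W j) \<le> ?F (K - {j}) v"
      by metis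
    have face: "?F K v = ?F (K - {j}) v" if "j \<in> K" "v j = 0" for j v
      using that psubset.hyps by (intro residual_cong) (simp add: sum.remove)
    define j0 where "j0 = arg_min_on (\<lambda>j. ?F (K - {j}) (W j)) K"
    have j0: "j0 \<in> K" "\<And>j. j \<in> K \<Longrightarrow> ?F (K - {j0}) (W j0) \<le> ?F (K - {j}) (W j)"
      using psubset.hyps k0 arg_min_if_finite[of K "\<lambda>j. ?F (K - {j}) (W j)"]
      by (auto simp: j0_def not_less)
    let ?w = "(W j0)(j0 := 0)"
    have "?F K ?w \<le> ?F K v" if v: "\<forall>k\<in>K. 0 \<le> v k" for v
    proof -
      \<comment> \<open>\<open>t\<close> is the largest step against the kernel direction \<open>d\<close> that keeps \<open>v\<close> nonnegative.\<close>
      define P where "P = {k\<in>K. d k \<noteq> 0}"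
      define t where "t = Min ((\<lambda>k. v k / d k) ` P)"
      have P: "finite P" "P \<noteq> {}"
        using psubset.hyps k0 by (auto simp: P_def)
      then have "t \<in> (\<lambda>k. v k / d k) ` P"
        unfolding t_def by (intro Min_in) auto
      then obtain j where j: "j \<in> K" "d j \<noteq> 0" "t = v j / d j"
        by (auto simp: P_def)
      have t: "t \<le> v k / d k" if "k \<in> K" "d k \<noteq> 0" for k
        using P that unfolding t_def by (intro Min_le) (auto simp: P_def)
      let ?v = "\<lambda>k. v k - t * d k"
      have nonneg: "\<forall>k\<in>K. 0 \<le> ?v k"
      proof
        fix k assume k: "k \<in> K"
        show "0 \<le> ?v k"
        proof (cases "d k = 0")
          case False
          then have "d k > 0" using d k by (simp add: order.not_eq_order_implies_strict)
          then show ?thesis using t[OF k False] by (simp add: pos_le_divide_eq)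
        qed (use v k in simp)
      qed
      have "?F K ?w = ?F (K - {j0}) ?w"
        using j0 by (intro face) auto
      also have "\<dots> = ?F (K - {j0}) (W j0)"
        by (intro residual_cong sum.cong) auto
      also have "\<dots> \<le> ?F (K - {j}) (W j)"
        using j j0 by blast
      also have "\<dots> \<le> ?F (K - {j}) ?v"
        using j nonneg by (intro Wmin) auto
      also have "\<dots> = ?F K ?v"
        using j by (intro face[symmetric]) auto
      also have "\<dots> = ?F K v"
        using d(2) by (intro residual_cong)
          (simp add: scaleR_diff_left sum_subtractf flip: scaleR_scaleR scaleR_sum_right)
      finally show ?thesis .
    qed
    moreover have "\<forall>k\<in>K. 0 \<le> ?w k"
      using W j0 by auto
    ultimately show ?thesis by blast
  next
    case False
    then obtain c where c: "c > 0"
      and le: "\<And>w. \<forall>k\<in>K. 0 \<le> w k \<Longrightarrow> c * (\<Sum>k\<in>K. w k) \<le> residual I a (\<lambda>_. 0) K w"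
      using residual_coercive[OF psubset.hyps I, of a] by blast
    let ?X = "{w :: 'k \<Rightarrow> real. \<forall>k\<in>K. 0 \<le> w k} \<inter> {w. \<forall>k\<in>- K. w k = 0}"
    have cl: "closed ?X"
      unfolding Ball_def
      by (intro closed_Int closed_Collect_all closed_Collect_imp open_Collect_const
          closed_Collect_le closed_Collect_eq continuous_intros continuous_on_product_coordinates)
    have F0: "?F K (\<lambda>_. 0) = L2_set (\<lambda>i. norm (b i)) I"
      by (simp add: residual_def)
    have bd: "\<bar>w k\<bar> \<le> 2 * ?F K (\<lambda>_. 0) / c" if w: "w \<in> ?X" "?F K w \<le> ?F K (\<lambda>_. 0)" for w k
    proof -
      let ?s = "\<lambda>i. \<Sum>k\<in>K. w k *\<^sub>R a k i"
      have "residual I a (\<lambda>_. 0) K w \<le> L2_set (\<lambda>i. norm (?s i - b i) + norm (b i)) I"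
        unfolding residual_def
        by (intro L2_set_mono) (simp_all add: norm_triangle_sub[of "?s _" "b _"] add.commute)
      also have "\<dots> \<le> ?F K w + L2_set (\<lambda>i. norm (b i)) I"
        unfolding residual_def by (rule L2_set_triangle_ineq)
      finally have "c * (\<Sum>k\<in>K. w k) \<le> 2 * ?F K (\<lambda>_. 0)"
        using le[of w] w F0 by simp
      then have s: "(\<Sum>k\<in>K. w k) \<le> 2 * ?F K (\<lambda>_. 0) / c"
        using c by (simp add: pos_le_divide_eq mult.commute)
      have s0: "0 \<le> (\<Sum>k\<in>K. w k)"
        using w by (intro sum_nonneg) auto
      show ?thesis
      proof (cases "k \<in> K")
        case True
        then have "w k \<le> (\<Sum>k\<in>K. w k)"
          using w psubset.hyps by (intro member_le_sum) auto
        then show ?thesis using s w True by auto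
      qed (use s s0 w in auto)
    qed
    have mem: "(\<lambda>_. 0) \<in> ?X" by simp
    have "\<exists>w\<in>?X. \<forall>v\<in>?X. ?F K w \<le> ?F K v"
      by (rule bounded_sublevel_attains_min[OF cl continuous_residual mem]) (rule bd)
    then obtain w where w: "w \<in> ?X" "\<And>v. v \<in> ?X \<Longrightarrow> ?F K w \<le> ?F K v" by blast
    have "?F K w \<le> ?F K v" if v: "\<forall>k\<in>K. 0 \<le> v k" for v
    proof -
      have "?F K w \<le> ?F K (\<lambda>k. if k \<in> K then v k else 0)"
        using v by (intro w(2)) auto
      also have "\<dots> = ?F K v"
        by (intro residual_cong sum.cong) auto
      finally show ?thesis .
    qed
    then show ?thesis using w(1) by blast
  qed
qed

section \<open>Convex quadratic programs\<close>

lemma quad_form_gram: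
  fixes M :: "real mat"
  assumes M: "M \<in> carrier_mat k m" and z: "z \<in> carrier_vec m"
  shows "quad_form (transpose_mat M * M) z = (M *\<^sub>v z) \<bullet> (M *\<^sub>v z)"
  using assms transpose_vec_mult_scalar[OF M z, of "M *\<^sub>v z"]
  by (simp add: quad_form_def assoc_mult_mat_vec[of _ m k] comm_scalar_prod[of z m])

lemma norm2_nonneg: "0 \<le> norm2 v"
  by (simp add: norm2_def L2_set_nonneg)

lemma norm2_square: "(norm2 v)\<^sup>2 = (\<Sum>i<dim_vec v. (norm (v $ i))\<^sup>2)"
  by (simp add: norm2_def L2_set_def sum_nonneg)

lemma norm2_square_real: "(norm2 (v :: real vec))\<^sup>2 = v \<bullet> v"
  by (simp add: norm2_square scalar_prod_def lessThan_atLeast0 flip: power2_eq_square)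

lemma scalar_prod_self_nonneg: "0 \<le> (v :: real vec) \<bullet> v"
  by (simp flip: norm2_square_real)

lemma residual_quadratic:
  fixes M :: "real mat"
  assumes M: "M \<in> carrier_mat k m" and r: "r \<in> carrier_vec k" and z: "z \<in> carrier_vec m"
  shows "(M *\<^sub>v z - r) \<bullet> (M *\<^sub>v z - r) =
    quad_form (transpose_mat M * M) z + (- 2 \<cdot>\<^sub>v (transpose_mat M *\<^sub>v r)) \<bullet> z + r \<bullet> r"
proof -
  have Mz: "M *\<^sub>v z \<in> carrier_vec k" using M z by simp
  have "(M *\<^sub>v z - r) \<bullet> (M *\<^sub>v z - r) =
      (M *\<^sub>v z) \<bullet> (M *\<^sub>v z) - 2 * (r \<bullet> (M *\<^sub>v z)) + r \<bullet> r"
    using Mz r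
    by (simp add: minus_scalar_prod_distrib[of _ k] scalar_prod_minus_distrib[of _ k]
        comm_scalar_prod[of "M *\<^sub>v z" k r])
  also have "r \<bullet> (M *\<^sub>v z) = (transpose_mat M *\<^sub>v r) \<bullet> z"
    using transpose_vec_mult_scalar[OF M z r] by simp
  finally show ?thesis
    using quad_form_gram[OF M z] M r z by simp
qed

lemma quad_form_gram_nonneg:
  fixes M :: "real mat"
  assumes "M \<in> carrier_mat k m" "z \<in> carrier_vec m"
  shows "0 \<le> quad_form (transpose_mat M * M) z"
  using assms by (simp add: quad_form_gram scalar_prod_self_nonneg)

lemma convex_quadratic_program_gram:
  fixes M :: "real mat"
  assumes M: "M \<in> carrier_mat p m" and q: "q \<in> carrier_vec m"
    and f: "\<And>z. z \<in> carrier_vec m \<Longrightarrow> f z = quad_form (transpose_mat M * M) z + q \<bullet> z + c"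
    and "A \<in> carrier_mat k m" "b \<in> carrier_vec k" "G \<in> carrier_mat l m" "h \<in> carrier_vec l"
    and "X = {z \<in> carrier_vec m. A *\<^sub>v z = b \<and> h \<le> G *\<^sub>v z}"
  shows "convex_quadratic_program m f X"
  unfolding convex_quadratic_program_def
  by (rule exI[of _ "transpose_mat M * M"], rule exI[of _ q], rule exI[of _ c], rule exI[of _ k],
      rule exI[of _ A], rule exI[of _ b], rule exI[of _ l], rule exI[of _ G], rule exI[of _ h])
    (use assms in \<open>auto simp: quad_form_gram_nonneg transpose_mult[of _ m p _ m]\<close>)

lemma mult_mat_vec_convex_combination:
  fixes A :: "real mat"
  assumes A: "A \<in> carrier_mat k m" and uv: "u \<in> carrier_vec m" "v \<in> carrier_vec m"
  shows "A *\<^sub>v ((1 - t) \<cdot>\<^sub>v u + t \<cdot>\<^sub>v v) = (1 - t) \<cdot>\<^sub>v (A *\<^sub>v u) + t \<cdot>\<^sub>v (A *\<^sub>v v)"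
  using assms by (simp add: mult_add_distrib_mat_vec[of _ k m] mult_mat_vec[of _ k m])

lemma convex_quadratic_program_feasible_convex:
  assumes "convex_quadratic_program m f X" and uv: "u \<in> X" "v \<in> X" and t: "0 \<le> t" "t \<le> 1"
  shows "(1 - t) \<cdot>\<^sub>v u + t \<cdot>\<^sub>v v \<in> X"
proof -
  obtain k A b l G h where A: "A \<in> carrier_mat k m" and b: "b \<in> carrier_vec k"
    and G: "G \<in> carrier_mat l m" and h: "h \<in> carrier_vec l"
    and X: "X = {z \<in> carrier_vec m. A *\<^sub>v z = b \<and> h \<le> G *\<^sub>v z}"
    using assms(1) unfolding convex_quadratic_program_def by blast
  let ?z = "(1 - t) \<cdot>\<^sub>v u + t \<cdot>\<^sub>v v"
  have "(1 - t) \<cdot>\<^sub>v b + t \<cdot>\<^sub>v b = b"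
    using b by (intro eq_vecI) (auto simp: algebra_simps)
  then have "A *\<^sub>v ?z = b"
    using uv by (simp add: X mult_mat_vec_convex_combination[OF A])
  moreover have "h \<le> G *\<^sub>v ?z"
  proof -
    have "h $ i \<le> (1 - t) * (G *\<^sub>v u) $ i + t * (G *\<^sub>v v) $ i" if "i < l" for i
    proof -
      have "h $ i = (1 - t) * h $ i + t * h $ i" by (simp add: algebra_simps)
      also have "\<dots> \<le> (1 - t) * (G *\<^sub>v u) $ i + t * (G *\<^sub>v v) $ i"
        using uv t that G unfolding X less_eq_vec_def
        by (intro add_mono mult_left_mono) auto
      finally show ?thesis .
    qed
    moreover have "G *\<^sub>v ?z = (1 - t) \<cdot>\<^sub>v (G *\<^sub>v u) + t \<cdot>\<^sub>v (G *\<^sub>v v)"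
      using uv by (simp add: X mult_mat_vec_convex_combination[OF G])
    ultimately show ?thesis
      using G h by (auto simp: less_eq_vec_def simp del: index_mult_mat_vec)
  qed
  ultimately show ?thesis using uv by (simp add: X)
qed

lemma strictly_convex_minimizer_unique:
  assumes "convex_quadratic_program m f X" and sc: "strictly_convex_on X f"
    and u: "minimizer f X u" and v: "minimizer f X v"
  shows "u = v"
proof (rule ccontr)
  assume "u \<noteq> v"
  let ?z = "(1 - 1/2) \<cdot>\<^sub>v u + (1/2) \<cdot>\<^sub>v v"
  have uv: "u \<in> X" "v \<in> X" "f u = f v"
    using u v by (auto simp: is_arg_min_linorder intro: antisym)
  then have "f ?z < (1 - 1/2) * f u + 1/2 * f v"
    using sc \<open>u \<noteq> v\<close> unfolding strictly_convex_on_def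
    by (elim ballE allE[of _ "1/2"]) auto
  moreover have "?z \<in> X"
    using assms(1) uv by (intro convex_quadratic_program_feasible_convex) auto
  ultimately show False
    using u uv by (auto simp: is_arg_min_linorder)
qed

lemma strictly_convex_on_add_affine:
  assumes sc: "strictly_convex_on X g" and X: "X \<subseteq> carrier_vec m" and q: "q \<in> carrier_vec m"
    and conv: "\<And>u v t. u \<in> X \<Longrightarrow> v \<in> X \<Longrightarrow> 0 < t \<Longrightarrow> t < 1 \<Longrightarrow> (1 - t) \<cdot>\<^sub>v u + t \<cdot>\<^sub>v v \<in> X"
    and f: "\<And>z. z \<in> X \<Longrightarrow> f z = g z + q \<bullet> z + c"
  shows "strictly_convex_on X f"
  unfolding strictly_convex_on_def
proof (intro ballI allI impI)
  fix u v :: "real vec" and t :: real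
  assume uv: "u \<in> X" "v \<in> X" "u \<noteq> v" and t: "0 < t" "t < 1"
  have "g ((1 - t) \<cdot>\<^sub>v u + t \<cdot>\<^sub>v v) < (1 - t) * g u + t * g v"
    using sc uv t by (simp add: strictly_convex_on_def)
  moreover have "q \<bullet> ((1 - t) \<cdot>\<^sub>v u + t \<cdot>\<^sub>v v) = (1 - t) * (q \<bullet> u) + t * (q \<bullet> v)"
    using uv(1,2)[THEN subsetD[OF X]] q by (simp add: scalar_prod_add_distrib[of _ m])
  ultimately show "f ((1 - t) \<cdot>\<^sub>v u + t \<cdot>\<^sub>v v) < (1 - t) * f u + t * f v"
    using f conv uv t by (simp add: algebra_simps)
qed

lemma quad_form_gram_convex_combination:
  fixes M :: "real mat"
  assumes M: "M \<in> carrier_mat k m" and uv: "u \<in> carrier_vec m" "v \<in> carrier_vec m"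
  defines "Q \<equiv> transpose_mat M * M"
  shows "quad_form Q ((1 - t) \<cdot>\<^sub>v u + t \<cdot>\<^sub>v v) =
    (1 - t) * quad_form Q u + t * quad_form Q v - t * (1 - t) * quad_form Q (v - u)"
proof -
  define a b where "a = M *\<^sub>v u" and "b = M *\<^sub>v v"
  have ab: "a \<in> carrier_vec k" "b \<in> carrier_vec k"
    using assms by (auto simp: a_def b_def)
  have "M *\<^sub>v (v - u) = b - a"
    using assms by (simp add: a_def b_def mult_minus_distrib_mat_vec[of _ k m])
  then show ?thesis
    unfolding Q_def using M uv ab
    by (simp add: quad_form_gram[OF M] mult_mat_vec_convex_combination[OF M] flip: a_def b_def)
      (simp add: add_scalar_prod_distrib[of _ k] scalar_prod_add_distrib[of _ k]
        minus_scalar_prod_distrib[of _ k] scalar_prod_minus_distrib[of _ k]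
        comm_scalar_prod[of b k a] algebra_simps)
qed

section \<open>Complex least squares as real least squares\<close>

text \<open>The real parts of all rows, followed by the imaginary parts of all rows.\<close>

definition stack_mat :: "complex mat \<Rightarrow> real mat" where
  "stack_mat M = map_mat Re M @\<^sub>r map_mat Im M"

text \<open>The real parts of all entries, followed by the imaginary parts.\<close>

definition stack_vec :: "complex vec \<Rightarrow> real vec" where
  "stack_vec v = map_vec Re v @\<^sub>v map_vec Im v"

lemma stack_mat_carrier [simp]: "M \<in> carrier_mat k m \<Longrightarrow> stack_mat M \<in> carrier_mat (k + k) m"
  unfolding stack_mat_def by (intro carrier_append_rows) auto

lemma stack_vec_carrier [simp]: "v \<in> carrier_vec k \<Longrightarrow> stack_vec v \<in> carrier_vec (k + k)"
  by (simp add: stack_vec_def)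

lemma stack_mat_mult:
  assumes M: "M \<in> carrier_mat k m" and z: "z \<in> carrier_vec m"
  shows "stack_mat M *\<^sub>v z = stack_vec (M *\<^sub>v cvec z)"
  unfolding stack_mat_def stack_vec_def
proof (subst mat_mult_append)
  show "map_mat Re M *\<^sub>v z @\<^sub>v map_mat Im M *\<^sub>v z =
      map_vec Re (M *\<^sub>v cvec z) @\<^sub>v map_vec Im (M *\<^sub>v cvec z)"
    using M z by (intro arg_cong2[of _ _ _ _ "(@\<^sub>v)"] eq_vecI) (auto simp: scalar_prod_def)
qed (use M z in auto)

lemma stack_vec_eq_iff:
  assumes "u \<in> carrier_vec k" "v \<in> carrier_vec k"
  shows "stack_vec u = stack_vec v \<longleftrightarrow> u = v"
proof
  assume "stack_vec u = stack_vec v"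
  then have "map_vec Re u = map_vec Re v \<and> map_vec Im u = map_vec Im v"
    using assms unfolding stack_vec_def by (subst (asm) append_vec_eq[of _ k]) auto
  then show "u = v"
    using assms by (auto simp: vec_eq_iff complex_eq_iff)
qed simp

lemma norm2_square_stack: "(norm2 (v :: complex vec))\<^sup>2 = stack_vec v \<bullet> stack_vec v"
  unfolding stack_vec_def
  by (subst scalar_prod_append[of _ "dim_vec v" _ "dim_vec v"])
    (auto simp: norm2_square scalar_prod_def cmod_power2 sum.distrib lessThan_atLeast0
      simp flip: power2_eq_square)

lemma stack_vec_diff:
  assumes "u \<in> carrier_vec k" "v \<in> carrier_vec k"
  shows "stack_vec (u - v) = stack_vec u - stack_vec v"
  using assms by (intro eq_vecI) (auto simp: stack_vec_def)

lemma norm2_square_gram_real: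
  assumes M: "M \<in> carrier_mat k m" and z: "z \<in> carrier_vec m"
  shows "(norm2 (M *\<^sub>v cvec z))\<^sup>2 = quad_form (transpose_mat (stack_mat M) * stack_mat M) z"
  using assms by (simp add: norm2_square_stack quad_form_gram[of _ "k + k" m] stack_mat_mult)

lemma norm2_square_residual_real:
  assumes M: "M \<in> carrier_mat k m" and r: "r \<in> carrier_vec k" and z: "z \<in> carrier_vec m"
  shows "(norm2 (M *\<^sub>v cvec z - r))\<^sup>2 = quad_form (transpose_mat (stack_mat M) * stack_mat M) z
    + (- 2 \<cdot>\<^sub>v (transpose_mat (stack_mat M) *\<^sub>v stack_vec r)) \<bullet> z + stack_vec r \<bullet> stack_vec r"
proof -
  have "(norm2 (M *\<^sub>v cvec z - r))\<^sup>2 =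
      (stack_mat M *\<^sub>v z - stack_vec r) \<bullet> (stack_mat M *\<^sub>v z - stack_vec r)"
    using assms by (simp add: norm2_square_stack stack_vec_diff[of _ k] stack_mat_mult)
  then show ?thesis
    using assms by (simp add: residual_quadratic[of _ "k + k" m])
qed

lemma norm2_square_adjoint:
  assumes M: "M \<in> carrier_mat k m" and z: "z \<in> carrier_vec m"
  shows "complex_of_real ((norm2 (M *\<^sub>v cvec z))\<^sup>2) = quad_form (mat_adjoint M * M) (cvec z)"
proof -
  let ?w = "M *\<^sub>v cvec z"
  have adj: "mat_adjoint M = transpose_mat (map_mat cnj M)"
    using M by (intro eq_matI) (auto simp: mat_adjoint_def mat_of_rows_def conjugate_vec_def)
  have w: "?w \<in> carrier_vec k" using M z by simp
  have "quad_form (mat_adjoint M * M) (cvec z) = cvec z \<bullet> (transpose_mat (map_mat cnj M) *\<^sub>v ?w)"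
    using M z by (simp add: quad_form_def adj assoc_mult_mat_vec[of _ m k])
  also have "\<dots> = ?w \<bullet> (map_mat cnj M *\<^sub>v cvec z)"
    using transpose_vec_mult_scalar[of "map_mat cnj M" k m "cvec z" ?w] M z w
    by (simp add: comm_scalar_prod[of "cvec z" m])
  also have "map_mat cnj M *\<^sub>v cvec z = map_vec cnj ?w"
    using M z by (intro eq_vecI) (auto simp: scalar_prod_def)
  also have "?w \<bullet> map_vec cnj ?w = (\<Sum>i<k. ?w $ i * cnj (?w $ i))"
    using w M by (simp add: scalar_prod_def lessThan_atLeast0 del: index_mult_mat_vec)
  also have "\<dots> = complex_of_real ((norm2 ?w)\<^sup>2)"
    using M by (simp only: norm2_square of_real_sum complex_norm_square dim_mult_mat_vec carrier_matD)
  finally show ?thesis by simp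
qed

section \<open>Hankel structure\<close>

text \<open>Otherwise the simplifier rewrites the dimension \<open>2 * n - 1\<close> into \<open>2 * n - Suc 0\<close>.\<close>

declare One_nat_def [simp del]

lemma perturbation_eq:
  "z \<in> carrier_vec (2 * n - 1) \<Longrightarrow> perturbation n z = mat n n (\<lambda>(i, j). z $ (i + j))"
  by (simp add: perturbation_def hankel_S_mult_vec unvectorize_vectorize)

lemma perturbation_carrier [simp]: "perturbation n z \<in> carrier_mat n n"
  by (simp add: perturbation_def unvectorize_def)

lemma vectorize_carrier: "A \<in> carrier_mat n m \<Longrightarrow> vectorize A \<in> carrier_vec (n * m)"
  by (intro carrier_vecI) (auto simp: vectorize_def)

lemma hankel_carrier: "hankel n A \<Longrightarrow> A \<in> carrier_mat n n"
  by (simp add: hankel_def)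

lemma hankel_S_carrier [simp]: "hankel_S n \<in> carrier_mat (n * n) (2 * n - 1)"
  by (simp add: hankel_S_def)

lemma hankel_C_carrier [simp]: "x \<in> carrier_vec n \<Longrightarrow> hankel_C n x \<in> carrier_mat n (2 * n - 1)"
  unfolding hankel_C_def by (intro mult_carrier_mat[of _ n "n * n"]) (auto simp: kronecker_def)

text \<open>Under column stacking, position \<open>j * n + i\<close> belongs to the entry in row \<open>i\<close> and column \<open>j\<close>.\<close>

lemma sum_vec_index:
  fixes f :: "nat \<Rightarrow> 'b::comm_monoid_add"
  shows "(\<Sum>p<n * n. f p) = (\<Sum>j<n. \<Sum>i<n. f (j * n + i))"
proof -
  have "(\<Sum>p<n * n. f p) = (\<Sum>j<n. sum f {j * n..<j * n + n})"
    by (rule sum.nat_group[symmetric])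
  moreover have "sum f {j * n..<j * n + n} = (\<Sum>i<n. f (j * n + i))" for j
    using sum.shift_bounds_nat_ivl[of f 0 "j * n" n]
    by (simp add: lessThan_atLeast0 add.commute)
  ultimately show ?thesis by simp
qed

lemma kronecker_id_row_mult_vectorize:
  fixes A :: "'a::comm_ring_1 mat"
  assumes A: "A \<in> carrier_mat n n" and x: "x \<in> carrier_vec n"
  shows "kronecker (1\<^sub>m n) (mat_of_row x) *\<^sub>v vectorize A = transpose_mat A *\<^sub>v x"
proof (rule eq_vecI)
  fix i assume "i < dim_vec (transpose_mat A *\<^sub>v x)"
  then have i: "i < n" using A by simp
  have "(kronecker (1\<^sub>m n) (mat_of_row x) *\<^sub>v vectorize A) $ i =
      (\<Sum>p<n * n. 1\<^sub>m n $$ (i, p div n) * x $ (p mod n) * A $$ (p mod n, p div n))"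
    using A x i
    by (simp add: kronecker_def vectorize_def scalar_prod_def lessThan_atLeast0 mat_of_row_def)
  also have "\<dots> = (\<Sum>j<n. \<Sum>l<n. 1\<^sub>m n $$ (i, j) * x $ l * A $$ (l, j))"
    unfolding sum_vec_index by (intro sum.cong refl) auto
  also have "\<dots> = (\<Sum>j<n. if j = i then \<Sum>l<n. x $ l * A $$ (l, j) else 0)"
    using i by (intro sum.cong) auto
  also have "\<dots> = (\<Sum>l<n. x $ l * A $$ (l, i))"
    using i by simp
  also have "\<dots> = (transpose_mat A *\<^sub>v x) $ i"
    using A x i by (simp add: scalar_prod_def lessThan_atLeast0 mult.commute)
  finally show "(kronecker (1\<^sub>m n) (mat_of_row x) *\<^sub>v vectorize A) $ i = (transpose_mat A *\<^sub>v x) $ i" .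
qed (use A in \<open>simp add: kronecker_def\<close>)

text \<open>The transpose in the preceding lemma disappears because a Hankel matrix is symmetric.\<close>

lemma hankel_C_mult:
  assumes x: "x \<in> carrier_vec n" and z: "z \<in> carrier_vec (2 * n - 1)"
  shows "hankel_C n x *\<^sub>v cvec z = cmat (perturbation n z) *\<^sub>v x"
proof -
  let ?A = "mat n n (\<lambda>(i, j). cvec z $ (i + j))"
  have "hankel_C n x *\<^sub>v cvec z =
      kronecker (1\<^sub>m n) (mat_of_row x) *\<^sub>v (hankel_S n *\<^sub>v cvec z)"
    unfolding hankel_C_def using x z
    by (intro assoc_mult_mat_vec[of _ n "n * n" _ "2 * n - 1"]) (auto simp: kronecker_def)
  also have "\<dots> = transpose_mat ?A *\<^sub>v x"
    using x z by (simp add: hankel_S_mult_vec kronecker_id_row_mult_vectorize[of _ n])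
  also have "transpose_mat ?A = cmat (perturbation n z)"
    using z by (intro eq_matI) (auto simp: perturbation_eq add.commute)
  finally show ?thesis .
qed

lemma hankel_C_residual:
  assumes x: "x \<in> carrier_vec n" and z: "z \<in> carrier_vec (2 * n - 1)" and H: "H \<in> carrier_mat n n"
  shows "hankel_C n x *\<^sub>v cvec z - hankel_r H lam x =
    cmat (H + perturbation n z) *\<^sub>v x - lam \<cdot>\<^sub>v x"
proof -
  have "cmat (H + perturbation n z) = cmat H + cmat (perturbation n z)"
    using H carrier_matD[OF perturbation_carrier[of n z]] by (intro eq_matI) auto
  then have "cmat (H + perturbation n z) *\<^sub>v x = cmat H *\<^sub>v x + cmat (perturbation n z) *\<^sub>v x"
    using H x by (simp add: add_mult_distrib_mat_vec[of _ n n])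
  moreover have "b - (c - a) = a + b - c"
    if "a \<in> carrier_vec n" "b \<in> carrier_vec n" "c \<in> carrier_vec n" for a b c :: "complex vec"
    using that by (intro eq_vecI) auto
  moreover have "cmat H *\<^sub>v x \<in> carrier_vec n" "cmat (perturbation n z) *\<^sub>v x \<in> carrier_vec n"
    using H x by (auto intro!: mult_mat_vec_carrier)
  ultimately show ?thesis
    unfolding hankel_C_mult[OF x z] hankel_r_def using x by simp
qed

lemma hankel_C_eq_iff:
  assumes x: "x \<in> carrier_vec n" and z: "z \<in> carrier_vec (2 * n - 1)" and H: "H \<in> carrier_mat n n"
  shows "hankel_C n x *\<^sub>v cvec z = hankel_r H lam x \<longleftrightarrow>
    cmat (H + perturbation n z) *\<^sub>v x = lam \<cdot>\<^sub>v x"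
proof -
  have zero: "u = v \<longleftrightarrow> u - v = 0\<^sub>v n" if "u \<in> carrier_vec n" "v \<in> carrier_vec n"
    for u v :: "complex vec"
    using that by (auto simp: vec_eq_iff)
  have "hankel_C n x *\<^sub>v cvec z \<in> carrier_vec n" "hankel_r H lam x \<in> carrier_vec n"
    "cmat (H + perturbation n z) *\<^sub>v x \<in> carrier_vec n" "lam \<cdot>\<^sub>v x \<in> carrier_vec n"
    using assms by (auto simp: hankel_r_def intro!: mult_mat_vec_carrier)
  then show ?thesis
    using hankel_C_residual[OF assms] zero by metis
qed

lemma unvectorize_nonneg_iff:
  assumes H: "H \<in> carrier_mat n n" and v: "v \<in> carrier_vec (n * n)"
  shows "- vectorize H \<le> v \<longleftrightarrow> nonneg_mat (H + unvectorize n v)"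
proof
  assume le: "- vectorize H \<le> v"
  have "0 \<le> H $$ (i, j) + v $ (j * n + i)" if "i < n" "j < n" for i j
  proof -
    have "j * n + i < Suc j * n" using that by simp
    also have "\<dots> \<le> n * n" using that by (intro mult_le_mono1) simp
    finally have p: "j * n + i < n * n" .
    then have "(- vectorize H) $ (j * n + i) \<le> v $ (j * n + i)"
      using le v unfolding less_eq_vec_def by auto
    then show ?thesis
      using p that H by (simp add: vectorize_def)
  qed
  then show "nonneg_mat (H + unvectorize n v)"
    using H by (simp add: nonneg_mat_def unvectorize_def)
next
  assume nn: "nonneg_mat (H + unvectorize n v)"
  have "(- vectorize H) $ p \<le> v $ p" if p: "p < n * n" for p
  proof -
    have "0 < n" using p by (cases n) auto
    then have "p mod n < n" "p div n < n"
      using p by (simp_all add: less_mult_imp_div_less)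
    moreover have "\<forall>i<n. \<forall>j<n. 0 \<le> H $$ (i, j) + v $ (j * n + i)"
      using nn H by (simp add: nonneg_mat_def unvectorize_def)
    ultimately have "0 \<le> H $$ (p mod n, p div n) + v $ (p div n * n + p mod n)"
      by blast
    then show ?thesis
      using p H by (simp add: vectorize_def)
  qed
  then show "- vectorize H \<le> v"
    using H v by (simp add: less_eq_vec_def vectorize_def)
qed

section \<open>The two programs in terms of matrices\<close>

lemma mem_feasible_B_iff:
  assumes "H \<in> carrier_mat n n"
  shows "z \<in> feasible_B n H \<longleftrightarrow>
    z \<in> carrier_vec (2 * n - 1) \<and> nonneg_mat (H + perturbation n z)"
  using unvectorize_nonneg_iff[OF assms mult_mat_vec_carrier[OF hankel_S_carrier]]
  by (auto simp: feasible_B_def perturbation_def)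

lemma mem_feasible_A_iff:
  assumes "H \<in> carrier_mat n n" "x \<in> carrier_vec n"
  shows "z \<in> feasible_A n H lam x \<longleftrightarrow>
    z \<in> feasible_B n H \<and> cmat (H + perturbation n z) *\<^sub>v x = lam \<cdot>\<^sub>v x"
  using hankel_C_eq_iff[OF assms(2) _ assms(1)] by (auto simp: feasible_A_def feasible_B_def)

lemma frobenius_unvectorize:
  assumes v: "v \<in> carrier_vec (n * n)"
  shows "(frobenius (unvectorize n v))\<^sup>2 = (norm2 v)\<^sup>2"
proof -
  have "(norm2 v)\<^sup>2 = (\<Sum>j<n. \<Sum>i<n. (norm (v $ (j * n + i)))\<^sup>2)"
    unfolding norm2_square carrier_vecD[OF v] by (rule sum_vec_index)
  also have "\<dots> = (\<Sum>i<n. \<Sum>j<n. (norm (v $ (j * n + i)))\<^sup>2)"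
    by (rule sum.swap)
  also have "\<dots> = (frobenius (unvectorize n v))\<^sup>2"
    by (simp add: frobenius_def unvectorize_def sum_nonneg)
  finally show ?thesis by simp
qed

lemma objective_A_eq:
  assumes "z \<in> carrier_vec (2 * n - 1)"
  shows "objective_A n z = (frobenius (perturbation n z))\<^sup>2"
  unfolding objective_A_def perturbation_def
  using frobenius_unvectorize[OF mult_mat_vec_carrier[OF hankel_S_carrier assms]] by simp

lemma frobenius_nonneg: "0 \<le> frobenius A"
  by (simp add: frobenius_def sum_nonneg)

lemma hankel_add:
  assumes "hankel n A" "hankel n B"
  shows "hankel n ((A :: 'a::plus mat) + B)"
proof -
  obtain c d where c: "c \<in> carrier_vec (2 * n - 1)" "\<forall>i<n. \<forall>j<n. A $$ (i, j) = c $ (i + j)"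
    and d: "d \<in> carrier_vec (2 * n - 1)" "\<forall>i<n. \<forall>j<n. B $$ (i, j) = d $ (i + j)"
    and AB: "A \<in> carrier_mat n n" "B \<in> carrier_mat n n"
    using assms by (auto simp: hankel_def)
  then show ?thesis
    unfolding hankel_def by (intro conjI bexI[of _ "c + d"]) auto
qed

lemma hankel_perturbation: "z \<in> carrier_vec (2 * n - 1) \<Longrightarrow> hankel n (perturbation n z)"
  by (auto simp: hankel_iff_perturbation)

lemma hankel_uminus: "hankel n A \<Longrightarrow> hankel n (- A :: 'a::uminus mat)"
proof -
  assume "hankel n A"
  then obtain c where "A \<in> carrier_mat n n" "c \<in> carrier_vec (2 * n - 1)"
    "\<forall>i<n. \<forall>j<n. A $$ (i, j) = c $ (i + j)"
    by (auto simp: hankel_def)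
  then show "hankel n (- A)"
    unfolding hankel_def by (intro conjI bexI[of _ "- c"]) auto
qed

text \<open>Every Hankel matrix \<open>K\<close> is reached from \<open>H\<close> by a Hankel perturbation, namely \<open>K - H\<close>.\<close>

lemma hankel_eq_add_perturbation:
  assumes H: "hankel n (H :: real mat)" and K: "hankel n K"
  obtains z where "z \<in> carrier_vec (2 * n - 1)" "K = H + perturbation n z"
proof -
  have "hankel n (K + - H)"
    using assms by (intro hankel_add hankel_uminus)
  then obtain z where z: "z \<in> carrier_vec (2 * n - 1)" "K + - H = perturbation n z"
    using hankel_iff_perturbation by blast
  have "K = H + (K + - H)"
    using H K by (intro eq_matI) (auto dest!: hankel_carrier)
  with z that show ?thesis by metis
qed

lemma exact_perturbations_eq:
  assumes "H \<in> carrier_mat n n" "x \<in> carrier_vec n"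
  shows "exact_perturbations n H lam x = perturbation n ` feasible_A n H lam x"
  using assms
  by (auto simp: exact_perturbations_def hankel_iff_perturbation mem_feasible_A_iff
      mem_feasible_B_iff)

text \<open>
  Optimality transfers along a parameterization \<open>p\<close> of the competitors. Only one implication between
  the two orderings is needed, and only at the minimizer.
\<close>

lemma minimizer_image:
  assumes z: "minimizer f X z"
    and mono: "\<And>y. y \<in> X \<Longrightarrow> g (p y) < g (p z) \<Longrightarrow> f y < f z"
  shows "minimizer g (p ` X) (p z)"
  using assms by (auto simp: is_arg_min_def)

lemma minimizer_A_frobenius:
  assumes "H \<in> carrier_mat n n" "x \<in> carrier_vec n"
    and "minimizer (objective_A n) (feasible_A n H lam x) z"
  shows "minimizer frobenius (exact_perturbations n H lam x) (perturbation n z)"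
  unfolding exact_perturbations_eq[OF assms(1,2)]
  by (rule minimizer_image[OF assms(3)])
    (use assms(3) in \<open>auto simp: is_arg_min_def feasible_A_def objective_A_eq frobenius_nonneg
      intro!: power_strict_mono\<close>)

lemma objective_B_eq:
  assumes "x \<in> carrier_vec n" "z \<in> carrier_vec (2 * n - 1)" "H \<in> carrier_mat n n"
  shows "objective_B n H lam x z = (norm2 (cmat (H + perturbation n z) *\<^sub>v x - lam \<cdot>\<^sub>v x))\<^sup>2"
  using assms by (simp add: objective_B_def hankel_C_residual)

lemma minimizer_B_residual:
  assumes H: "hankel n H" and x: "x \<in> carrier_vec n"
    and z: "minimizer (objective_B n H lam x) (feasible_B n H) z"
  shows "minimizer (\<lambda>K. norm2 (cmat K *\<^sub>v x - lam \<cdot>\<^sub>v x)) {K. hankel n K \<and> nonneg_mat K}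
    (H + perturbation n z)"
proof -
  note Hc = hankel_carrier[OF H]
  have "{K. hankel n K \<and> nonneg_mat K} = (\<lambda>z. H + perturbation n z) ` feasible_B n H"
  proof (intro equalityI subsetI)
    fix K assume "K \<in> {K. hankel n K \<and> nonneg_mat K}"
    then obtain z where "z \<in> carrier_vec (2 * n - 1)" "K = H + perturbation n z" "nonneg_mat K"
      using hankel_eq_add_perturbation[OF H] by (metis mem_Collect_eq)
    then show "K \<in> (\<lambda>z. H + perturbation n z) ` feasible_B n H"
      by (auto simp: mem_feasible_B_iff[OF Hc])
  qed (auto simp: mem_feasible_B_iff[OF Hc] intro!: hankel_add H hankel_perturbation)
  moreover have "minimizer (\<lambda>K. norm2 (cmat K *\<^sub>v x - lam \<cdot>\<^sub>v x))
      ((\<lambda>z. H + perturbation n z) ` feasible_B n H) (H + perturbation n z)"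
  proof (rule minimizer_image[OF z])
    fix y assume "y \<in> feasible_B n H"
      "norm2 (cmat (H + perturbation n y) *\<^sub>v x - lam \<cdot>\<^sub>v x)
        < norm2 (cmat (H + perturbation n z) *\<^sub>v x - lam \<cdot>\<^sub>v x)"
    then show "objective_B n H lam x y < objective_B n H lam x z"
      using z by (auto simp: objective_B_eq[OF x _ Hc] feasible_B_def is_arg_min_def norm2_nonneg
          intro!: power_strict_mono)
  qed
  ultimately show ?thesis by simp
qed

section \<open>Convexity of the two programs\<close>

lemma objective_A_quadratic:
  assumes "z \<in> carrier_vec (2 * n - 1)"
  shows "objective_A n z = quad_form (transpose_mat (hankel_S n) * hankel_S n) z"
  unfolding objective_A_def norm2_square_real
  using assms by (simp add: quad_form_gram[of _ "n * n" "2 * n - 1"])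

lemma convex_quadratic_program_A:
  assumes H: "H \<in> carrier_mat n n" and x: "x \<in> carrier_vec n"
  shows "convex_quadratic_program (2 * n - 1) (objective_A n) (feasible_A n H lam x)"
proof (rule convex_quadratic_program_gram)
  show "objective_A n z = quad_form (transpose_mat (hankel_S n) * hankel_S n) z
      + 0\<^sub>v (2 * n - 1) \<bullet> z + 0" if "z \<in> carrier_vec (2 * n - 1)" for z
    using that by (simp add: objective_A_quadratic)
  have r: "hankel_r H lam x \<in> carrier_vec n"
    using assms by (auto simp: hankel_r_def intro!: mult_mat_vec_carrier)
  show "feasible_A n H lam x = {z \<in> carrier_vec (2 * n - 1).
      stack_mat (hankel_C n x) *\<^sub>v z = stack_vec (hankel_r H lam x) \<and>
      - vectorize H \<le> hankel_S n *\<^sub>v z}"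
    using x r unfolding feasible_A_def
    by (auto simp: stack_mat_mult[OF hankel_C_carrier[OF x]] stack_vec_eq_iff[of _ n]
        mult_mat_vec_carrier[OF hankel_C_carrier[OF x]])
  show "stack_vec (hankel_r H lam x) \<in> carrier_vec (n + n)"
    using r by simp
  show "- vectorize H \<in> carrier_vec (n * n)"
    using vectorize_carrier[OF H] by simp
qed (rule hankel_S_carrier zero_carrier_vec stack_mat_carrier[OF hankel_C_carrier[OF x]])+

lemma objective_B_quadratic:
  assumes x: "x \<in> carrier_vec n" and H: "H \<in> carrier_mat n n"
  obtains q c where "q \<in> carrier_vec (2 * n - 1)"
    "\<And>z. z \<in> carrier_vec (2 * n - 1) \<Longrightarrow> objective_B n H lam x z =
      quad_form (transpose_mat (stack_mat (hankel_C n x)) * stack_mat (hankel_C n x)) z + q \<bullet> z + c"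
proof -
  let ?M = "stack_mat (hankel_C n x)"
  have r: "hankel_r H lam x \<in> carrier_vec n"
    using assms by (auto simp: hankel_r_def intro!: mult_mat_vec_carrier)
  have "- 2 \<cdot>\<^sub>v (transpose_mat ?M *\<^sub>v stack_vec (hankel_r H lam x)) \<in> carrier_vec (2 * n - 1)"
    using stack_mat_carrier[OF hankel_C_carrier[OF x]] stack_vec_carrier[OF r]
    by (intro smult_carrier_vec[THEN iffD2] mult_mat_vec_carrier) auto
  with that show thesis
    using norm2_square_residual_real[OF hankel_C_carrier[OF x] r] unfolding objective_B_def
    by blast
qed

lemma convex_quadratic_program_B:
  assumes H: "H \<in> carrier_mat n n" and x: "x \<in> carrier_vec n"
  shows "convex_quadratic_program (2 * n - 1) (objective_B n H lam x) (feasible_B n H)"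
proof -
  obtain q c where q: "q \<in> carrier_vec (2 * n - 1)"
    and f: "\<And>z. z \<in> carrier_vec (2 * n - 1) \<Longrightarrow> objective_B n H lam x z =
      quad_form (transpose_mat (stack_mat (hankel_C n x)) * stack_mat (hankel_C n x)) z + q \<bullet> z + c"
    using objective_B_quadratic[OF x H] by blast
  show ?thesis
  proof (rule convex_quadratic_program_gram[OF _ q f])
    show "feasible_B n H = {z \<in> carrier_vec (2 * n - 1).
        0\<^sub>m 0 (2 * n - 1) *\<^sub>v z = 0\<^sub>v 0 \<and> - vectorize H \<le> hankel_S n *\<^sub>v z}"
      by (auto simp: feasible_B_def)
    show "- vectorize H \<in> carrier_vec (n * n)"
      using vectorize_carrier[OF H] by simp
    show "0\<^sub>m 0 (2 * n - 1) \<in> carrier_mat 0 (2 * n - 1)" "0\<^sub>v 0 \<in> carrier_vec 0"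
      by simp_all
    show "hankel_S n \<in> carrier_mat (n * n) (2 * n - 1)"
      by (rule hankel_S_carrier)
  qed (rule stack_mat_carrier[OF hankel_C_carrier[OF x]])
qed

lemma strictly_convex_objective_B:
  assumes H: "H \<in> carrier_mat n n" and x: "x \<in> carrier_vec n"
    and sc: "strictly_convex_on (feasible_B n H) (\<lambda>z. (norm2 (hankel_C n x *\<^sub>v cvec z))\<^sup>2)"
  shows "strictly_convex_on (feasible_B n H) (objective_B n H lam x)"
proof -
  obtain q c where q: "q \<in> carrier_vec (2 * n - 1)"
    and f: "\<And>z. z \<in> carrier_vec (2 * n - 1) \<Longrightarrow> objective_B n H lam x z =
      quad_form (transpose_mat (stack_mat (hankel_C n x)) * stack_mat (hankel_C n x)) z + q \<bullet> z + c"
    using objective_B_quadratic[OF x H] by blast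
  show ?thesis
    by (rule strictly_convex_on_add_affine[OF sc _ q])
      (use convex_quadratic_program_feasible_convex[OF convex_quadratic_program_B[OF H x]] in
        \<open>auto simp: f feasible_B_def norm2_square_gram_real[OF hankel_C_carrier[OF x]]\<close>)
qed

lemma positive_definite_imp_strictly_convex:
  assumes x: "x \<in> carrier_vec n"
    and pd: "positive_definite_on {d \<in> carrier_vec (2 * n - 1). hankel_C n x *\<^sub>v cvec d = 0\<^sub>v n}
      (transpose_mat (hankel_S n) * hankel_S n)"
  shows "strictly_convex_on (feasible_A n H lam x)
    (quad_form (transpose_mat (hankel_S n) * hankel_S n))"
  unfolding strictly_convex_on_def
proof (intro ballI allI impI)
  let ?Q = "transpose_mat (hankel_S n) * hankel_S n :: real mat"
  fix u v :: "real vec" and t :: real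
  assume u: "u \<in> feasible_A n H lam x" and v: "v \<in> feasible_A n H lam x"
    and "u \<noteq> v" and t: "0 < t" "t < 1"
  have uv: "u \<in> carrier_vec (2 * n - 1)" "v \<in> carrier_vec (2 * n - 1)"
    using u v by (auto simp: feasible_A_def)
  have C: "hankel_C n x *\<^sub>v cvec u \<in> carrier_vec n"
    using uv x by (intro mult_mat_vec_carrier[OF hankel_C_carrier]) auto
  have "cvec (v - u) = cvec v - cvec u"
    using uv by (intro eq_vecI) auto
  then have "hankel_C n x *\<^sub>v cvec (v - u) = hankel_C n x *\<^sub>v cvec v - hankel_C n x *\<^sub>v cvec u"
    using uv by (simp add: mult_minus_distrib_mat_vec[OF hankel_C_carrier[OF x]])
  also have "\<dots> = 0\<^sub>v n"
    using u v C by (simp add: feasible_A_def)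
  finally have "hankel_C n x *\<^sub>v cvec (v - u) = 0\<^sub>v n" .
  moreover have "v - u \<noteq> 0\<^sub>v (2 * n - 1)"
    using \<open>u \<noteq> v\<close> uv by (auto simp: vec_eq_iff)
  ultimately have "0 < quad_form ?Q (v - u)"
    using pd uv by (auto simp: positive_definite_on_def)
  then have "0 < t * (1 - t) * quad_form ?Q (v - u)"
    using t by simp
  then show "quad_form ?Q ((1 - t) \<cdot>\<^sub>v u + t \<cdot>\<^sub>v v)
      < (1 - t) * quad_form ?Q u + t * quad_form ?Q v"
    using quad_form_gram_convex_combination[OF hankel_S_carrier uv, of t] by linarith
qed

section \<open>Existence and uniqueness of minimizers\<close>

lemma objective_A_sum:
  assumes "z \<in> carrier_vec (2 * n - 1)"
  shows "objective_A n z = (\<Sum>i<n. \<Sum>j<n. (z $ (i + j))\<^sup>2)"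
  using assms by (simp add: objective_A_eq perturbation_eq frobenius_def sum_nonneg)

lemma antidiagonal_index:
  fixes k n :: nat
  assumes "k < 2 * n - 1"
  obtains i j where "i < n" "j < n" "k = i + j"
proof
  show "min k (n - 1) < n" "k - min k (n - 1) < n" "k = min k (n - 1) + (k - min k (n - 1))"
    using assms by auto
qed

lemma component_le_objective_A:
  assumes z: "z \<in> carrier_vec (2 * n - 1)" and k: "k < 2 * n - 1"
  shows "(z $ k)\<^sup>2 \<le> objective_A n z"
proof -
  obtain i j where ij: "i < n" "j < n" "k = i + j"
    using antidiagonal_index[OF k] by blast
  have "(z $ (i + j))\<^sup>2 \<le> (\<Sum>j<n. (z $ (i + j))\<^sup>2)"
    using ij by (intro member_le_sum) auto
  also have "\<dots> \<le> (\<Sum>i<n. \<Sum>j<n. (z $ (i + j))\<^sup>2)"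
    using ij by (intro member_le_sum sum_nonneg) auto
  finally show ?thesis
    using ij z by (simp add: objective_A_sum)
qed

text \<open>
  The feasible set is transported to the function space \<open>nat \<Rightarrow> real\<close>, which carries a topology;
  \<open>vec\<close> reads off the first \<open>2 * n - 1\<close> values.
\<close>

lemma closed_feasible_A:
  assumes x: "x \<in> carrier_vec n" and H: "H \<in> carrier_mat n n"
  shows "closed {w. vec (2 * n - 1) w \<in> feasible_A n H lam x}"
proof -
  let ?m = "2 * n - 1"
  have C: "hankel_C n x \<in> carrier_mat n ?m" by (rule hankel_C_carrier[OF x])
  have S: "(hankel_S n :: real mat) \<in> carrier_mat (n * n) ?m" by (rule hankel_S_carrier)
  have r: "hankel_r H lam x \<in> carrier_vec n"
    using assms by (auto simp: hankel_r_def intro!: mult_mat_vec_carrier)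
  have Cw: "(hankel_C n x *\<^sub>v cvec (vec ?m w)) $ i =
      (\<Sum>k<?m. hankel_C n x $$ (i, k) * complex_of_real (w k))" if "i < n" for i w
    using C that by (simp add: scalar_prod_def lessThan_atLeast0)
  have Sw: "(hankel_S n *\<^sub>v vec ?m w) $ p = (\<Sum>k<?m. hankel_S n $$ (p, k) * w k)"
    if "p < n * n" for p and w :: "nat \<Rightarrow> real"
    using that index_mult_mat_vec[of p "hankel_S n" "vec ?m w"] carrier_matD[OF S]
    by (simp add: scalar_prod_def lessThan_atLeast0)
  have "hankel_C n x *\<^sub>v cvec (vec ?m w) = hankel_r H lam x \<longleftrightarrow>
      (\<forall>i. i < n \<longrightarrow> (hankel_C n x *\<^sub>v cvec (vec ?m w)) $ i = hankel_r H lam x $ i)" for w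
    using carrier_matD(1)[OF C] carrier_vecD[OF r]
    unfolding vec_eq_iff dim_mult_mat_vec by simp
  moreover have "- vectorize H \<le> hankel_S n *\<^sub>v vec ?m w \<longleftrightarrow>
      (\<forall>p. p < n * n \<longrightarrow> (- vectorize H) $ p \<le> (hankel_S n *\<^sub>v vec ?m w) $ p)" for w
    using carrier_matD(1)[OF S] carrier_vecD[OF vectorize_carrier[OF H]]
    unfolding less_eq_vec_def dim_mult_mat_vec index_uminus_vec(2) by simp
  ultimately have "{w. vec ?m w \<in> feasible_A n H lam x} =
      {w. (\<forall>i. i < n \<longrightarrow> (\<Sum>k<?m. hankel_C n x $$ (i, k) * complex_of_real (w k)) =
            hankel_r H lam x $ i) \<and>
          (\<forall>p. p < n * n \<longrightarrow> (- vectorize H) $ p \<le> (\<Sum>k<?m. hankel_S n $$ (p, k) * w k))}"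
    by (simp add: feasible_A_def Cw Sw del: index_mult_mat_vec index_uminus_vec)
  also have "closed \<dots>"
    by (intro closed_Collect_conj closed_Collect_all closed_Collect_imp open_Collect_const
        closed_Collect_le closed_Collect_eq continuous_intros continuous_on_product_coordinates)
  finally show ?thesis .
qed

lemma minimizer_A_exists:
  assumes x: "x \<in> carrier_vec n" and H: "H \<in> carrier_mat n n"
    and ne: "feasible_A n H lam x \<noteq> {}"
  shows "\<exists>z. minimizer (objective_A n) (feasible_A n H lam x) z"
proof -
  let ?m = "2 * n - 1"
  let ?X = "{w. vec ?m w \<in> feasible_A n H lam x} \<inter> {w. \<forall>k. ?m \<le> k \<longrightarrow> w k = 0}"
  let ?f = "\<lambda>w. objective_A n (vec ?m w)"
  have carrier: "z \<in> carrier_vec ?m" if "z \<in> feasible_A n H lam x" for z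
    using that by (simp add: feasible_A_def)
  have restrict: "vec ?m (\<lambda>k. if k < ?m then z $ k else 0) = z" if "z \<in> carrier_vec ?m" for z :: "real vec"
    using that by (intro eq_vecI) auto
  obtain z0 where z0: "z0 \<in> feasible_A n H lam x" using ne by blast
  \<comment> \<open>Weights are extended by zero, so that the bound on the components below \<open>2 * n - 1\<close> bounds them all.\<close>
  define w0 where "w0 = (\<lambda>k. if k < ?m then z0 $ k else 0)"
  have w0: "w0 \<in> ?X"
    using z0 restrict[OF carrier[OF z0]] by (auto simp: w0_def)
  have cl: "closed ?X"
    by (intro closed_Int closed_feasible_A x H closed_Collect_all closed_Collect_imp
        open_Collect_const closed_Collect_eq continuous_intros continuous_on_product_coordinates)
  have "?f = (\<lambda>w. \<Sum>i<n. \<Sum>j<n. (w (i + j))\<^sup>2)"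
    by (intro ext) (simp add: objective_A_sum)
  then have cont: "continuous_on UNIV ?f"
    by (simp only:) (intro continuous_intros continuous_on_product_coordinates)
  have bd: "\<bar>w k\<bar> \<le> sqrt (?f w0)" if "w \<in> ?X" "?f w \<le> ?f w0" for w k
  proof (cases "k < ?m")
    case True
    then have "(w k)\<^sup>2 \<le> ?f w"
      using component_le_objective_A[of "vec ?m w" n k] by simp
    then show ?thesis
      using that(2) by (intro real_le_rsqrt) simp
  next
    case False
    then show ?thesis
      using that(1) by (simp add: objective_A_def)
  qed
  have "\<exists>w\<in>?X. \<forall>v\<in>?X. ?f w \<le> ?f v"
    by (rule bounded_sublevel_attains_min[OF cl cont w0]) (rule bd)
  then obtain w where w: "w \<in> ?X" "\<And>v. v \<in> ?X \<Longrightarrow> ?f w \<le> ?f v" by blast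
  have "minimizer (objective_A n) (feasible_A n H lam x) (vec ?m w)"
    unfolding is_arg_min_linorder
  proof (intro conjI allI impI)
    fix z assume z: "z \<in> feasible_A n H lam x"
    then show "?f w \<le> objective_A n z"
      using w(2)[of "\<lambda>k. if k < ?m then z $ k else 0"] restrict[OF carrier[OF z]] by simp
  qed (use w in simp)
  then show ?thesis by blast
qed

lemma nonneg_perturbation_iff:
  assumes z: "z \<in> carrier_vec (2 * n - 1)"
  shows "nonneg_mat (perturbation n z) \<longleftrightarrow> (\<forall>k<2 * n - 1. 0 \<le> z $ k)"
proof
  assume "nonneg_mat (perturbation n z)"
  then have "\<forall>i<n. \<forall>j<n. 0 \<le> z $ (i + j)"
    using z by (simp add: nonneg_mat_def perturbation_eq)
  then show "\<forall>k<2 * n - 1. 0 \<le> z $ k"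
    by (metis antidiagonal_index)
qed (use z in \<open>simp add: nonneg_mat_def perturbation_eq\<close>)

lemma perturbation_add:
  assumes "y \<in> carrier_vec (2 * n - 1)" "z \<in> carrier_vec (2 * n - 1)"
  shows "perturbation n (y + z) = perturbation n y + perturbation n z"
  using assms by (intro eq_matI) (auto simp: perturbation_eq)

lemma minimizer_B_exists:
  assumes x: "x \<in> carrier_vec n" and H: "hankel n H"
  shows "\<exists>z. minimizer (objective_B n H lam x) (feasible_B n H) z"
proof -
  let ?m = "2 * n - 1" and ?C = "hankel_C n x"
  note Hc = hankel_carrier[OF H]
  have C: "?C \<in> carrier_mat n ?m" by (rule hankel_C_carrier[OF x])
  obtain c where c: "c \<in> carrier_vec ?m" and Hp: "H = perturbation n c"
    using H hankel_iff_perturbation by blast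
  let ?R = "residual {..<n} (\<lambda>k i. ?C $$ (i, k)) (\<lambda>i. lam * x $ i) {..<?m}"
  \<comment> \<open>The shift by \<open>c\<close> turns the nonnegativity constraint into the orthant.\<close>
  have feas: "z \<in> feasible_B n H \<longleftrightarrow> z \<in> carrier_vec ?m \<and> (\<forall>k<?m. 0 \<le> c $ k + z $ k)" for z
  proof (cases "z \<in> carrier_vec ?m")
    case True
    then have "H + perturbation n z = perturbation n (c + z)"
      using perturbation_add[OF c] Hp by simp
    then show ?thesis
      using True c nonneg_perturbation_iff[of "c + z" n] by (simp add: mem_feasible_B_iff[OF Hc])
  qed (simp add: feasible_B_def)
  have obj: "objective_B n H lam x z = (?R (\<lambda>k. c $ k + z $ k))\<^sup>2" if z: "z \<in> carrier_vec ?m" for z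
  proof -
    have cz: "c + z \<in> carrier_vec ?m" using c z by simp
    have Hz: "H + perturbation n z = perturbation n (c + z)"
      using perturbation_add[OF c z] Hp by simp
    have "objective_B n H lam x z = (norm2 (?C *\<^sub>v cvec (c + z) - lam \<cdot>\<^sub>v x))\<^sup>2"
      unfolding objective_B_eq[OF x z Hc] Hz hankel_C_mult[OF x cz] ..
    also have "norm2 (?C *\<^sub>v cvec (c + z) - lam \<cdot>\<^sub>v x) = ?R (\<lambda>k. c $ k + z $ k)"
      unfolding norm2_def residual_def using C c z x
      by (intro L2_set_cong) (auto simp: scalar_prod_def lessThan_atLeast0 scaleR_conv_of_real
          mult.commute intro!: arg_cong[of _ _ norm] sum.cong)
    finally show ?thesis .
  qed
  obtain u where u: "\<forall>k\<in>{..<?m}. 0 \<le> u k"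
    and min: "\<And>v. \<forall>k\<in>{..<?m}. 0 \<le> v k \<Longrightarrow> ?R u \<le> ?R v"
    using nonneg_residual_attains_min[of "{..<?m}" "{..<n}" "\<lambda>k i. ?C $$ (i, k)" "\<lambda>i. lam * x $ i"]
    by blast
  let ?z = "vec ?m (\<lambda>k. u k - c $ k)"
  have Ru: "?R (\<lambda>k. c $ k + ?z $ k) = ?R u"
    by (intro residual_cong sum.cong) auto
  have "minimizer (objective_B n H lam x) (feasible_B n H) ?z"
    unfolding is_arg_min_linorder
  proof (intro conjI allI impI)
    show "?z \<in> feasible_B n H"
      using u by (simp add: feas)
    fix y assume y: "y \<in> feasible_B n H"
    then have "?R u \<le> ?R (\<lambda>k. c $ k + y $ k)"
      by (intro min) (auto simp: feas)
    then show "objective_B n H lam x ?z \<le> objective_B n H lam x y"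
      using y by (simp add: obj feas Ru residual_nonneg power_mono)
  qed
  then show ?thesis by blast
qed

lemma minimizer_A_unique:
  assumes x: "x \<in> carrier_vec n" and H: "H \<in> carrier_mat n n"
    and sc: "strictly_convex_on (feasible_A n H lam x)
      (quad_form (transpose_mat (hankel_S n) * hankel_S n))"
    and "minimizer (objective_A n) (feasible_A n H lam x) u"
    and "minimizer (objective_A n) (feasible_A n H lam x) v"
  shows "u = v"
proof -
  note qp = convex_quadratic_program_A[OF H x, of lam]
  have "strictly_convex_on (feasible_A n H lam x) (objective_A n)"
  proof (rule strictly_convex_on_add_affine[OF sc])
    show "feasible_A n H lam x \<subseteq> carrier_vec (2 * n - 1)"
      by (auto simp: feasible_A_def)
    show "(1 - t) \<cdot>\<^sub>v u + t \<cdot>\<^sub>v v \<in> feasible_A n H lam x"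
      if "u \<in> feasible_A n H lam x" "v \<in> feasible_A n H lam x" "0 < t" "t < 1" for u v t
      using that by (intro convex_quadratic_program_feasible_convex[OF qp]) auto
    show "objective_A n z = quad_form (transpose_mat (hankel_S n) * hankel_S n) z
        + 0\<^sub>v (2 * n - 1) \<bullet> z + 0" if "z \<in> feasible_A n H lam x" for z
      using that by (simp add: feasible_A_def objective_A_quadratic)
  qed simp
  then show ?thesis
    using strictly_convex_minimizer_unique[OF qp] assms by blast
qed

lemma minimizer_B_unique:
  assumes x: "x \<in> carrier_vec n" and H: "H \<in> carrier_mat n n"
    and sc: "strictly_convex_on (feasible_B n H) (\<lambda>z. (norm2 (hankel_C n x *\<^sub>v cvec z))\<^sup>2)"
    and "minimizer (objective_B n H lam x) (feasible_B n H) u"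
    and "minimizer (objective_B n H lam x) (feasible_B n H) v"
  shows "u = v"
  using strictly_convex_minimizer_unique[OF convex_quadratic_program_B[OF H x]
      strictly_convex_objective_B[OF H x sc]] assms by blast

section \<open>Minimizers of (B) need not have minimal Frobenius norm\<close>

lemma minimizer_B_not_frobenius_minimal:
  assumes n: "n \<ge> 1"
  shows "\<exists>H' lam' x' z'. hankel n H' \<and> x' \<in> carrier_vec n \<and> x' \<noteq> 0\<^sub>v n
    \<and> feasible_A n H' lam' x' = {}
    \<and> minimizer (objective_B n H' lam' x') (feasible_B n H') z'
    \<and> \<not> minimizer frobenius {D. hankel n D \<and> nonneg_mat (H' + D)} (perturbation n z')"
proof -
  let ?m = "2 * n - 1"
  let ?H = "0\<^sub>m n n :: real mat" and ?lam = "Complex 1 1"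
  let ?x = "vec n (\<lambda>_. 1) :: complex vec" and ?z = "vec ?m (\<lambda>_. 1 / real n)"
  have x: "?x \<in> carrier_vec n" and Hc: "?H \<in> carrier_mat n n" by auto
  have zc: "?z \<in> carrier_vec ?m" by simp
  have H: "hankel n ?H"
    unfolding hankel_def by (intro conjI bexI[of _ "0\<^sub>v ?m"]) auto
  have nz: "?x \<noteq> 0\<^sub>v n"
    using n by (auto simp: vec_eq_iff intro!: exI[of _ 0])
  have row: "(cmat (?H + perturbation n z) *\<^sub>v ?x) $ i = complex_of_real (\<Sum>j<n. z $ (i + j))"
    if "z \<in> carrier_vec ?m" "i < n" for z i
    using that by (simp add: perturbation_eq scalar_prod_def lessThan_atLeast0)
  have inf: "feasible_A n ?H ?lam ?x = {}"
  proof (rule equals0I)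
    fix z assume "z \<in> feasible_A n ?H ?lam ?x"
    then have z: "z \<in> carrier_vec ?m"
      and "cmat (?H + perturbation n z) *\<^sub>v ?x = ?lam \<cdot>\<^sub>v ?x"
      by (auto simp: mem_feasible_A_iff[OF Hc x] mem_feasible_B_iff[OF Hc])
    then have "complex_of_real (\<Sum>j<n. z $ (0 + j)) = ?lam"
      using row[OF z, of 0] n by simp
    then show False by (simp add: complex_eq_iff)
  qed
  \<comment> \<open>Row sums are real, so each row contributes at least \<open>1\<close>, the square of the imaginary part of the
    eigenvalue; equality holds when all row sums are \<open>1\<close>.\<close>
  have obj: "objective_B n ?H ?lam ?x z = (\<Sum>i<n. ((\<Sum>j<n. z $ (i + j)) - 1)\<^sup>2 + 1)"
    if z: "z \<in> carrier_vec ?m" for z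
  proof -
    have "objective_B n ?H ?lam ?x z =
        (\<Sum>i<n. (cmod (complex_of_real (\<Sum>j<n. z $ (i + j)) - ?lam))\<^sup>2)"
      unfolding objective_B_eq[OF x z Hc] norm2_square using row[OF z]
      by (intro sum.cong) (auto simp del: index_mult_mat_vec)
    then show ?thesis by (simp add: cmod_power2 Re_sum Im_sum)
  qed
  have minB: "minimizer (objective_B n ?H ?lam ?x) (feasible_B n ?H) ?z"
    unfolding is_arg_min_linorder
  proof (intro conjI allI impI)
    have "nonneg_mat (perturbation n ?z)"
      using nonneg_perturbation_iff[OF zc] by simp
    then show "?z \<in> feasible_B n ?H"
      using zc by (simp add: mem_feasible_B_iff[OF Hc])
    fix y assume "y \<in> feasible_B n ?H"
    then have y: "y \<in> carrier_vec ?m" by (simp add: feasible_B_def)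
    have "(\<Sum>j<n. ?z $ (i + j)) = 1" if "i < n" for i
      using that n by simp
    then have "objective_B n ?H ?lam ?x ?z = (\<Sum>i<n. 1)"
      unfolding obj[OF zc] by (intro sum.cong) auto
    also have "\<dots> \<le> objective_B n ?H ?lam ?x y"
      unfolding obj[OF y] by (intro sum_mono) auto
    finally show "objective_B n ?H ?lam ?x ?z \<le> objective_B n ?H ?lam ?x y" .
  qed
  have "\<not> minimizer frobenius {D. hankel n D \<and> nonneg_mat (?H + D)} (perturbation n ?z)"
  proof -
    have "0 < (?z $ 0)\<^sup>2" using n by simp
    also have "\<dots> \<le> objective_A n ?z"
      using n by (intro component_le_objective_A[OF zc]) simp
    finally have "0 < frobenius (perturbation n ?z)"
      using frobenius_nonneg[of "perturbation n ?z"] by (simp add: objective_A_eq[OF zc])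
    moreover have "frobenius ?H = 0"
      by (simp add: frobenius_def)
    moreover have "nonneg_mat (?H + ?H)"
      by (simp add: nonneg_mat_def)
    ultimately show ?thesis
      using H unfolding is_arg_min_def mem_Collect_eq by metis
  qed
  with H x nz inf minB show ?thesis
    by (intro exI conjI)
qed

section \<open>The Hankel eigenpair problem\<close>

theorem theorem1:
  fixes n :: nat and H :: "real mat" and lam :: complex and x :: "complex vec"
  assumes "n \<ge> 1"
    and "hankel n H"
    and "x \<in> carrier_vec n"
    and "x \<noteq> 0\<^sub>v n"
  shows "(((\<exists>K D. K = H + D \<and> hankel n D \<and> hankel n K \<and> nonneg_mat K \<and> cmat K *\<^sub>v x = lam \<cdot>\<^sub>v x)
        \<longleftrightarrow> feasible_A n H lam x \<noteq> {})
     \<and> (\<forall>z \<in> feasible_A n H lam x.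
          hankel n (H + perturbation n z) \<and> nonneg_mat (H + perturbation n z)
          \<and> cmat (H + perturbation n z) *\<^sub>v x = lam \<cdot>\<^sub>v x))
     \<and>
     (feasible_A n H lam x \<noteq> {} \<longrightarrow>
       (\<forall>z. minimizer (objective_A n) (feasible_A n H lam x) z \<longrightarrow>
          nonneg_mat (H + perturbation n z)
          \<and> cmat (H + perturbation n z) *\<^sub>v x = lam \<cdot>\<^sub>v x
          \<and> minimizer frobenius (exact_perturbations n H lam x) (perturbation n z))
       \<and> convex_quadratic_program (2 * n - 1) (objective_A n) (feasible_A n H lam x)
       \<and> (\<exists>z. minimizer (objective_A n) (feasible_A n H lam x) z)
       \<and> (strictly_convex_on (feasible_A n H lam x)
             (quad_form (transpose_mat (hankel_S n) * hankel_S n)) \<longrightarrow>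
            (\<exists>!z. minimizer (objective_A n) (feasible_A n H lam x) z)
            \<and> (\<exists>!D. \<exists>z. minimizer (objective_A n) (feasible_A n H lam x) z
                         \<and> D = perturbation n z))
       \<and> (positive_definite_on
             {d \<in> carrier_vec (2 * n - 1). hankel_C n x *\<^sub>v cvec d = 0\<^sub>v n}
             (transpose_mat (hankel_S n) * hankel_S n) \<longrightarrow>
            strictly_convex_on (feasible_A n H lam x)
              (quad_form (transpose_mat (hankel_S n) * hankel_S n))))
     \<and>
     ((feasible_A n H lam x = {} \<longrightarrow>
       (\<forall>z. minimizer (objective_B n H lam x) (feasible_B n H) z \<longrightarrow>
          hankel n (H + perturbation n z) \<and> nonneg_mat (H + perturbation n z)
          \<and> norm2 (cmat (H + perturbation n z) *\<^sub>v x - lam \<cdot>\<^sub>v x)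
              = norm2 (hankel_C n x *\<^sub>v cvec z - hankel_r H lam x)
          \<and> minimizer (\<lambda>K. norm2 (cmat K *\<^sub>v x - lam \<cdot>\<^sub>v x)) {K. hankel n K \<and> nonneg_mat K}
              (H + perturbation n z)))
     \<and> convex_quadratic_program (2 * n - 1) (objective_B n H lam x) (feasible_B n H)
     \<and> (\<exists>z. minimizer (objective_B n H lam x) (feasible_B n H) z)
     \<and> (\<forall>z \<in> carrier_vec (2 * n - 1).
          complex_of_real ((norm2 (hankel_C n x *\<^sub>v cvec z))\<^sup>2)
            = quad_form (mat_adjoint (hankel_C n x) * hankel_C n x) (cvec z))
     \<and> (strictly_convex_on (feasible_B n H) (\<lambda>z. (norm2 (hankel_C n x *\<^sub>v cvec z))\<^sup>2) \<longrightarrow>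
          (\<exists>!z. minimizer (objective_B n H lam x) (feasible_B n H) z)))
     \<and>
     ((feasible_A n H lam x \<noteq> {} \<longrightarrow>
       (\<forall>z. minimizer (objective_A n) (feasible_A n H lam x) z \<longrightarrow>
          norm2 (hankel_C n x *\<^sub>v cvec z - hankel_r H lam x) = 0
          \<and> minimizer frobenius (exact_perturbations n H lam x) (perturbation n z)))
     \<and> (feasible_A n H lam x = {} \<longrightarrow>
       (\<forall>z. minimizer (objective_B n H lam x) (feasible_B n H) z \<longrightarrow>
          minimizer (\<lambda>K. norm2 (cmat K *\<^sub>v x - lam \<cdot>\<^sub>v x)) {K. hankel n K \<and> nonneg_mat K}
            (H + perturbation n z)))
     \<and> (\<exists>H' lam' x' z'. hankel n H' \<and> x' \<in> carrier_vec n \<and> x' \<noteq> 0\<^sub>v n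
          \<and> feasible_A n H' lam' x' = {}
          \<and> minimizer (objective_B n H' lam' x') (feasible_B n H') z'
          \<and> \<not> minimizer frobenius {D. hankel n D \<and> nonneg_mat (H' + D)} (perturbation n z')))"
proof -
  let ?A = "feasible_A n H lam x" and ?B = "feasible_B n H"
  let ?P = "perturbation n"
  let ?fA = "objective_A n" and ?fB = "objective_B n H lam x"
  let ?res = "\<lambda>K. norm2 (cmat K *\<^sub>v x - lam \<cdot>\<^sub>v x)"
  note H = \<open>hankel n H\<close> and x = \<open>x \<in> carrier_vec n\<close>
  note Hc = hankel_carrier[OF H]
  have B: "z \<in> carrier_vec (2 * n - 1) \<and> hankel n (H + ?P z) \<and> nonneg_mat (H + ?P z)"
    if "z \<in> ?B" for z
    using that hankel_add[OF H hankel_perturbation[of z n]] by (simp add: mem_feasible_B_iff[OF Hc])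
  have A: "z \<in> ?B \<and> cmat (H + ?P z) *\<^sub>v x = lam \<cdot>\<^sub>v x" if "z \<in> ?A" for z
    using that by (simp add: mem_feasible_A_iff[OF Hc x])
  have feasible: "?A \<noteq> {}"
    if "hankel n D" "nonneg_mat (H + D)" "cmat (H + D) *\<^sub>v x = lam \<cdot>\<^sub>v x" for D
  proof -
    have "D \<in> exact_perturbations n H lam x"
      using that by (simp add: exact_perturbations_def)
    then show ?thesis
      by (auto simp: exact_perturbations_eq[OF Hc x])
  qed
  have equivalence: "(\<exists>K D. K = H + D \<and> hankel n D \<and> hankel n K \<and> nonneg_mat K \<and>
      cmat K *\<^sub>v x = lam \<cdot>\<^sub>v x) \<longleftrightarrow> ?A \<noteq> {}"
    using feasible A B hankel_perturbation by (metis all_not_in_conv)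
  have minA: "z \<in> ?A" if "minimizer ?fA ?A z" for z
    using that by (simp add: is_arg_min_def)
  have minB: "z \<in> ?B" if "minimizer ?fB ?B z" for z
    using that by (simp add: is_arg_min_def)
  have residual_zero: "norm2 (hankel_C n x *\<^sub>v cvec z - hankel_r H lam x) = 0" if "z \<in> ?A" for z
  proof -
    have "hankel_r H lam x \<in> carrier_vec n"
      using Hc x by (auto simp: hankel_r_def intro!: mult_mat_vec_carrier)
    then show ?thesis
      using that by (simp add: feasible_A_def norm2_def L2_set_def)
  qed
  have uniqueA: "(\<exists>!z. minimizer ?fA ?A z) \<and> (\<exists>!D. \<exists>z. minimizer ?fA ?A z \<and> D = ?P z)"
    if "?A \<noteq> {}"
      "strictly_convex_on ?A (quad_form (transpose_mat (hankel_S n) * hankel_S n))"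
    using minimizer_A_exists[OF x Hc that(1)] minimizer_A_unique[OF x Hc that(2)] by metis
  have uniqueB: "\<exists>!z. minimizer ?fB ?B z"
    if "strictly_convex_on ?B (\<lambda>z. (norm2 (hankel_C n x *\<^sub>v cvec z))\<^sup>2)"
    using minimizer_B_exists[OF x H, of lam] minimizer_B_unique[OF x Hc that] by metis
  have residual: "?res (H + ?P z) = norm2 (hankel_C n x *\<^sub>v cvec z - hankel_r H lam x)"
    if "z \<in> ?B" for z
    using hankel_C_residual[OF x _ Hc] B[OF that] by simp
  show ?thesis
    apply (intro conjI impI ballI allI)
    subgoal by (rule equivalence)
    subgoal using A B by blast
    subgoal using A B by blast
    subgoal using A B by blast
    subgoal using A B minA by blast
    subgoal using A B minA by blast
    subgoal by (rule minimizer_A_frobenius[OF Hc x])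
    subgoal by (rule convex_quadratic_program_A[OF Hc x])
    subgoal by (rule minimizer_A_exists[OF x Hc])
    subgoal using uniqueA by blast
    subgoal using uniqueA by blast
    subgoal by (rule positive_definite_imp_strictly_convex[OF x])
    subgoal using B minB by blast
    subgoal using B minB by blast
    subgoal using residual minB by blast
    subgoal by (rule minimizer_B_residual[OF H x])
    subgoal by (rule convex_quadratic_program_B[OF Hc x])
    subgoal by (rule minimizer_B_exists[OF x H])
    subgoal by (rule norm2_square_adjoint[OF hankel_C_carrier[OF x]])
    subgoal by (rule uniqueB)
    subgoal using residual_zero minA by blast
    subgoal by (rule minimizer_A_frobenius[OF Hc x])
    subgoal by (rule minimizer_B_residual[OF H x])
    subgoal by (rule minimizer_B_not_frobenius_minimal[OF \<open>n \<ge> 1\<close>])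
    done
qed

end
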